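(* Let $\Sigma=(\sigma_{r,s})_{1\le r,s\le m}$ be the asymptotic covariance matrix of an irreducible, aperiodic, homogeneous Markov chain on $\mathcal{A}_m=\{\alpha_1<\cdots<\alpha_m\}$ with transition matrix $P$ and stationary distribution $(\pi_1,\dots,\pi_m)$, and let $\tau,\sigma_r,d_r,m_r,I_{s,d}$ and the Brownian motion $(\tilde B^1,\dots,\tilde B^m)$ be as defined in the context. Then, for every $1\le r\le m-1$, $$V_\infty^r:=\sum_{i=1}^{m_r}\sigma_{\tau(i)}\tilde B^{\tau(i)}(1)+\max_{t_{\cdot,\cdot}\in I_{r-m_r,d_r}}\sum_{j=1}^{r-m_r}\ \sum_{\ell=j}^{m_r+d_r-r+j}\sigma_{\tau(m_r+\ell)}\tilde B^{\tau(m_r+\ell)}(\Delta t_{j,\ell})$$ is equal in law to $$\sum_{i=m_r+d_r+1}^{m}\sigma_{\tau(i)}\tilde B^{\tau(i)}(1)+\max_{u_{\cdot,\cdot}\in I_{m_r+d_r-r,d_r}}\sum_{j=1}^{m_r+d_r-r}\ \sum_{\ell=j}^{r-m_r+j}\sigma_{\tau(m_r+\ell)}\tilde B^{\tau(m_r+\ell)}(\Delta u_{j,\ell}),$$ where $\tilde B^\ell(\Delta):=\tilde B^\ell(t)-\tilde B^\ell(s)$ for $\Delta=[s,t]$, $\Delta t_{j,\ell}=[t_{j,\ell-1},t_{j,\ell}]$, $\Delta u_{j,\ell}=[u_{j,\ell-1},u_{j,\ell}]$, and where the non-maximal terms in the first and second expressions are identically zero if $m_r=0$ or $m_r+d_r=m$,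 respectively (and the maximal term in the second expression is zero if $m_r+d_r=r$).
   Context: Here $m\ge 2$. Asymptotic covariance matrix: let $P=S^{-1}\Lambda S$ be a Jordan decomposition where the rows of $S$ are generalized left eigenvectors of $P$, the first row of $S$ is $(\pi_1,\dots,\pi_m)$, and $\Lambda=\mathrm{diag}(1,\tilde\Lambda)$ with $\tilde\Lambda$ an $(m-1)\times(m-1)$ lower Jordan-block matrix. Put $D=\mathrm{diag}(-1/2,\tilde\Lambda(I-\tilde\Lambda)^{-1})$, $\Pi=\mathrm{diag}(\pi_1,\dots,\pi_m)$. Then $\Sigma=\Pi+\Pi(S^{-1}DS)+(S^{-1}DS)^T\Pi$, and $\sigma_r=\sqrt{\sigma_{r,r}}$. The process $(\tilde B^1(t),\dots,\tilde B^m(t))_{0\le t\le1}$ is an $m$-dimensional centered Brownian motion with covariance matrix at time $t$ having entries $t\sigma_{r,s}/(\sigma_r\sigma_s)$. $\tau$ is the permutation of $\{1,\dots,m\}$ with $\pi_{\tau(i)}\ge\pi_{\tau(i+1)}$ for all $i$ and $\tau(i)<\tau(j)$ whenever $\pi_{\tau(i)}=\pi_{\tau(j)}$, $i<j$. $d_r$ is the number of $i$ with $\pi_i=\pi_{\tau(r)}$. $m_r=0$ if $\pi_{\tau(r)}=\pi_{\tau(1)}$ and $m_r=\max\{i:\pi_{\tau(i)}>\pi_{\tau(r)}\}$ otherwise. For positive integers $s\le d$, $I_{s,d}$ is the set of real arrays $(t_{j,\ell})_{1\le j\le s,\,0\le\ell\le d}$ such that $t_{j,\ell}=0$ for $0\le\ell\le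 j-1$; $t_{j,\ell}=1$ for $d-s+j\le\ell\le d$; $t_{j,\ell-1}\le t_{j,\ell}$ for $1\le\ell\le d$; and $t_{j+1,\ell+1}\le t_{j,\ell}$ for $1\le j\le s-1$, $0\le\ell\le d-1$. *)

theory Defs
  imports "HOL-Probability.Probability" "Jordan_Normal_Form.Jordan_Normal_Form"
    "Jordan_Normal_Form.Gauss_Jordan_Elimination"
begin

text \<open>
  The letter \<open>\<alpha>\<^sub>k\<^sub>+\<^sub>1\<close> of the ordered alphabet is represented by the index \<open>k \<in> {0..<m}\<close>, so that
  letters can index the matrices of the library. Ranks \<open>r\<close>, \<open>i\<close>, \<open>\<ell>\<close> (the arguments of \<open>\<tau>\<close>) run
  over \<open>{1..m}\<close>, hence \<open>\<tau>\<close> maps \<open>{1..m}\<close> to \<open>{0..<m}\<close>.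
\<close>

section \<open>The Markov chain\<close>

definition stochastic_mat :: "nat \<Rightarrow> real mat \<Rightarrow> bool" where
  "stochastic_mat m P \<longleftrightarrow> P \<in> carrier_mat m m \<and>
     (\<forall>i<m. \<forall>j<m. P $$ (i, j) \<ge> 0) \<and> (\<forall>i<m. (\<Sum>j<m. P $$ (i, j)) = 1)"

definition irreducible_chain :: "nat \<Rightarrow> real mat \<Rightarrow> bool" where
  "irreducible_chain m P \<longleftrightarrow> (\<forall>i<m. \<forall>j<m. \<exists>n\<ge>1. (P ^\<^sub>m n) $$ (i, j) > 0)"

definition aperiodic_chain :: "nat \<Rightarrow> real mat \<Rightarrow> bool" where
  "aperiodic_chain m P \<longleftrightarrow> (\<forall>i<m. Gcd {n. n \<ge> 1 \<and> (P ^\<^sub>m n) $$ (i, i) > 0} = 1)"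

definition stationary_distribution :: "nat \<Rightarrow> real mat \<Rightarrow> (nat \<Rightarrow> real) \<Rightarrow> bool" where
  "stationary_distribution m P \<pi> \<longleftrightarrow>
     (\<forall>i<m. \<pi> i \<ge> 0) \<and> (\<Sum>i<m. \<pi> i) = 1 \<and> (\<forall>j<m. (\<Sum>i<m. \<pi> i * P $$ (i, j)) = \<pi> j)"

section \<open>The asymptotic covariance matrix\<close>

text \<open>
  The library's Jordan blocks are upper triangular, whence the transpose. The eigenvalues of \<open>P\<close>
  may be non-real, so the decomposition is one over the complex numbers. That the rows of \<open>S\<close>
  are generalized left eigenvectors of \<open>P\<close> is the identity \<open>S P = diag(1, L) S\<close>.
\<close>

definition lower_jordan_matrix :: "complex mat \<Rightarrow> bool" where
  "lower_jordan_matrix L \<longleftrightarrow> (\<exists>n_as. 0 \<notin> fst ` set n_as \<and> L = transpose_mat (jordan_matrix n_as))"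

definition jordan_decomposition ::
    "nat \<Rightarrow> real mat \<Rightarrow> (nat \<Rightarrow> real) \<Rightarrow> complex mat \<Rightarrow> complex mat \<Rightarrow> complex mat \<Rightarrow> bool" where
  "jordan_decomposition m P \<pi> S S_inv L \<longleftrightarrow>
     L \<in> carrier_mat (m - 1) (m - 1) \<and> lower_jordan_matrix L \<and>
     similar_mat_wit (map_mat complex_of_real P) (diag_block_mat [1\<^sub>m 1, L]) S_inv S \<and>
     (\<forall>j<m. S $$ (0, j) = complex_of_real (\<pi> j))"

text \<open>
  The matrix is given by a complex formula whose value is real. That value does not depend on the
  Jordan decomposition, and \<open>I - L\<close> is invertible since 1 is a simple eigenvalue of \<open>P\<close>.
\<close>

definition asymptotic_covariance :: "nat \<Rightarrow> real mat \<Rightarrow> (nat \<Rightarrow> real) \<Rightarrow> real mat \<Rightarrow> bool" where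
  "asymptotic_covariance m P \<pi> \<Sigma> \<longleftrightarrow> \<Sigma> \<in> carrier_mat m m \<and>
     (\<exists>S S_inv L. jordan_decomposition m P \<pi> S S_inv L \<and>
        (let D = diag_block_mat [mat_diag 1 (\<lambda>_. - 1 / 2), L * the (mat_inverse (1\<^sub>m (m - 1) - L))];
             Z = S_inv * D * S;
             Pi = mat_diag m (\<lambda>i. complex_of_real (\<pi> i))
         in map_mat complex_of_real \<Sigma> = Pi + Pi * Z + transpose_mat Z * Pi))"

definition std_dev :: "real mat \<Rightarrow> nat \<Rightarrow> real" where
  "std_dev \<Sigma> r = sqrt (\<Sigma> $$ (r, r))"

section \<open>Brownian motion\<close>

definition centered_normal :: "real \<Rightarrow> real measure" where
  "centered_normal v = (if v = 0 then return borel 0 else density lborel (normal_density 0 (sqrt v)))"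

text \<open>
  A random vector is centered Gaussian if all linear combinations of its coordinates are centered
  normal. The covariance may be singular, as it is in the application, where the coordinates of
  the underlying unnormalized vector sum to 0.
\<close>

definition centered_gaussian_vector ::
    "'a measure \<Rightarrow> nat \<Rightarrow> (nat \<Rightarrow> nat \<Rightarrow> real) \<Rightarrow> (nat \<Rightarrow> 'a \<Rightarrow> real) \<Rightarrow> bool" where
  "centered_gaussian_vector M m C X \<longleftrightarrow> (\<forall>i<m. X i \<in> borel_measurable M) \<and>
     (\<forall>c. distr M borel (\<lambda>\<omega>. \<Sum>i<m. c i * X i \<omega>) =
          centered_normal (\<Sum>i<m. \<Sum>j<m. c i * c j * C i j))"

text \<open>
  \<open>B i t\<close> is the \<open>i\<close>-th coordinate at time \<open>t\<close>; the matrix \<open>C\<close> is the covariance at time 1.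
\<close>

definition brownian_motion ::
    "'a measure \<Rightarrow> nat \<Rightarrow> (nat \<Rightarrow> nat \<Rightarrow> real) \<Rightarrow> (nat \<Rightarrow> real \<Rightarrow> 'a \<Rightarrow> real) \<Rightarrow> bool" where
  "brownian_motion M m C B \<longleftrightarrow> prob_space M \<and>
     (\<forall>i<m. \<forall>t\<in>{0..1}. B i t \<in> borel_measurable M) \<and>
     (\<forall>i<m. \<forall>\<omega>\<in>space M. B i 0 \<omega> = 0 \<and> continuous_on {0..1} (\<lambda>t. B i t \<omega>)) \<and>
     (\<forall>n t. 0 \<le> t 0 \<and> (\<forall>k<n. t k \<le> t (Suc k)) \<and> t n \<le> 1 \<longrightarrow>
        prob_space.indep_vars M (\<lambda>_. \<Pi>\<^sub>M i\<in>{..<m}. borel)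
          (\<lambda>k \<omega>. \<lambda>i\<in>{..<m}. B i (t (Suc k)) \<omega> - B i (t k) \<omega>) {..<n}) \<and>
     (\<forall>s t. 0 \<le> s \<and> s \<le> t \<and> t \<le> 1 \<longrightarrow>
        centered_gaussian_vector M m (\<lambda>i j. (t - s) * C i j) (\<lambda>i \<omega>. B i t \<omega> - B i s \<omega>))"

definition equal_in_law :: "'a measure \<Rightarrow> ('a \<Rightarrow> real) \<Rightarrow> ('a \<Rightarrow> real) \<Rightarrow> bool" where
  "equal_in_law M X Y \<longleftrightarrow>
     X \<in> borel_measurable M \<and> Y \<in> borel_measurable M \<and> distr M borel X = distr M borel Y"

section \<open>The limiting functionals\<close>

definition sorting_permutation :: "nat \<Rightarrow> (nat \<Rightarrow> real) \<Rightarrow> (nat \<Rightarrow> nat) \<Rightarrow> bool" where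
  "sorting_permutation m \<pi> \<tau> \<longleftrightarrow> bij_betw \<tau> {1..m} {0..<m} \<and>
     (\<forall>i\<in>{1..<m}. \<pi> (\<tau> i) \<ge> \<pi> (\<tau> (i + 1))) \<and>
     (\<forall>i\<in>{1..m}. \<forall>j\<in>{1..m}. i < j \<and> \<pi> (\<tau> i) = \<pi> (\<tau> j) \<longrightarrow> \<tau> i < \<tau> j)"

definition d_mult :: "nat \<Rightarrow> (nat \<Rightarrow> real) \<Rightarrow> (nat \<Rightarrow> nat) \<Rightarrow> nat \<Rightarrow> nat" where
  "d_mult m \<pi> \<tau> r = card {i. i < m \<and> \<pi> i = \<pi> (\<tau> r)}"

definition m_above :: "nat \<Rightarrow> (nat \<Rightarrow> real) \<Rightarrow> (nat \<Rightarrow> nat) \<Rightarrow> nat \<Rightarrow> nat" where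
  "m_above m \<pi> \<tau> r =
     (if \<pi> (\<tau> r) = \<pi> (\<tau> 1) then 0 else Max {i \<in> {1..m}. \<pi> (\<tau> i) > \<pi> (\<tau> r)})"

text \<open>
  The array \<open>(t\<^sub>j\<^sub>,\<^sub>\<ell>)\<close> is a function of the pair \<open>(j, \<ell>)\<close>, undefined off its index set.
\<close>

definition I_set :: "nat \<Rightarrow> nat \<Rightarrow> (nat \<times> nat \<Rightarrow> real) set" where
  "I_set s d = {t \<in> extensional ({1..s} \<times> {0..d}).
     (\<forall>j\<in>{1..s}. \<forall>l\<in>{0..j - 1}. t (j, l) = 0) \<and>
     (\<forall>j\<in>{1..s}. \<forall>l\<in>{d - s + j..d}. t (j, l) = 1) \<and>
     (\<forall>j\<in>{1..s}. \<forall>l\<in>{1..d}. t (j, l - 1) \<le> t (j, l)) \<and>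
     (\<forall>j\<in>{1..<s}. \<forall>l\<in>{0..<d}. t (j + 1, l + 1) \<le> t (j, l))}"

text \<open>
  In both functionals the first sum is empty, hence 0, in the respective boundary case
  \<open>m\<^sub>r = 0\<close> or \<open>m\<^sub>r + d\<^sub>r = m\<close>. Since \<open>m\<^sub>r < r \<le> m\<^sub>r + d\<^sub>r\<close>, no subtraction below truncates. The use
  of \<open>GREATEST\<close> rather than a supremum makes the maxima attained ones.
\<close>

definition V_low ::
    "nat \<Rightarrow> (nat \<Rightarrow> real) \<Rightarrow> (nat \<Rightarrow> nat) \<Rightarrow> (nat \<Rightarrow> real) \<Rightarrow> (nat \<Rightarrow> real \<Rightarrow> 'a \<Rightarrow> real) \<Rightarrow> nat \<Rightarrow> 'a \<Rightarrow> real"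
  where
  "V_low m \<pi> \<tau> \<sigma> B r \<omega> = (let m\<^sub>r = m_above m \<pi> \<tau> r; d\<^sub>r = d_mult m \<pi> \<tau> r in
     (\<Sum>i=1..m\<^sub>r. \<sigma> (\<tau> i) * B (\<tau> i) 1 \<omega>) +
     (GREATEST y. \<exists>t\<in>I_set (r - m\<^sub>r) d\<^sub>r.
        y = (\<Sum>j=1..r - m\<^sub>r. \<Sum>l=j..m\<^sub>r + d\<^sub>r - r + j. \<sigma> (\<tau> (m\<^sub>r + l)) *
               (B (\<tau> (m\<^sub>r + l)) (t (j, l)) \<omega> - B (\<tau> (m\<^sub>r + l)) (t (j, l - 1)) \<omega>))))"

definition V_high ::
    "nat \<Rightarrow> (nat \<Rightarrow> real) \<Rightarrow> (nat \<Rightarrow> nat) \<Rightarrow> (nat \<Rightarrow> real) \<Rightarrow> (nat \<Rightarrow> real \<Rightarrow> 'a \<Rightarrow> real) \<Rightarrow> nat \<Rightarrow> 'a \<Rightarrow> real"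
  where
  "V_high m \<pi> \<tau> \<sigma> B r \<omega> = (let m\<^sub>r = m_above m \<pi> \<tau> r; d\<^sub>r = d_mult m \<pi> \<tau> r in
     (\<Sum>i=m\<^sub>r + d\<^sub>r + 1..m. \<sigma> (\<tau> i) * B (\<tau> i) 1 \<omega>) +
     (if m\<^sub>r + d\<^sub>r = r then 0 else
      GREATEST y. \<exists>u\<in>I_set (m\<^sub>r + d\<^sub>r - r) d\<^sub>r.
        y = (\<Sum>j=1..m\<^sub>r + d\<^sub>r - r. \<Sum>l=j..r - m\<^sub>r + j. \<sigma> (\<tau> (m\<^sub>r + l)) *
               (B (\<tau> (m\<^sub>r + l)) (u (j, l)) \<omega> - B (\<tau> (m\<^sub>r + l)) (u (j, l - 1)) \<omega>))))"

end

(*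
  The k = r - m_r paths of an array t in I_{k,d} occupy, at every time, k distinct letters of the
  block of ties, and they move upwards. The d - k unoccupied letters move downwards, so after the
  time reversal s |-> 1 - s they form an array u in I_{d-k,d}. A path passes from the letter l to
  l + 1 exactly when an unoccupied letter passes from l + 1 to l, whence u_{i,l} = 1 - t_{l-i+1,l}.
  The value of u on X'(s) = X(1 - s) - X(1) is that of t on X minus the sum of all X_l(1).
  The entries of the covariance matrix sum to 0, so almost surely the endpoints sigma_i B^i(1)
  sum to 0. Hence the first functional of B is almost surely the second functional of the
  process B(1 - s) - B(1), which has the same law as B.
*)
theory Submission
  imports Defs
begin

section \<open>Arrays and their complements\<close>

text \<open>Reversal is a statement about whole paths, while \<open>brownian_motion\<close> only
  gives independence of increments and laws of linear combinations, and the maximum runs over a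
  continuum of arrays. The maximum is therefore approximated by maxima over arrays with entries in a
  grid, which are functions of finitely many increments. A Cramer--Wold theorem gives the joint law
  of these, and characteristic functions carry the equality of laws to the limit.

  That the entries of \<Sigma> sum to 0 is hidden by the Jordan form. The source is Poisson's
  equation: \<open>S_inv * D * S\<close> differs by explicit terms from a matrix W that inverts I -
  P on vectors of \<pi>-mean 0, and for g = W f the quadratic form of \<Sigma> at f is the
  \<pi>-mean of g^2 - (P g)^2. For constant f this vanishes; in probabilistic terms, the letter
  counts add up to the length of the word.

  The motion is normalised by quotients in which x / 0 = 0. Nonnegativity of \<Sigma> shows that the
  normalisation loses nothing: a zero variance forces its whole row to vanish.\<close>

definition path_sum :: "nat \<Rightarrow> nat \<Rightarrow> (nat \<Rightarrow> real \<Rightarrow> real) \<Rightarrow> (nat \<times> nat \<Rightarrow> real) \<Rightarrow> real" where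
  "path_sum s d X t = (\<Sum>j=1..s. \<Sum>l=j..d - s + j. X l (t (j, l)) - X l (t (j, l - 1)))"

text \<open>The shape is that of the maxima in \<open>V_low\<close> and \<open>V_high\<close>.
  \<open>GREATEST\<close> says nothing about the value until a greatest element has been
  exhibited.\<close>

definition max_path_sum :: "nat \<Rightarrow> nat \<Rightarrow> (nat \<Rightarrow> real \<Rightarrow> real) \<Rightarrow> real" where
  "max_path_sum s d X = (GREATEST y. \<exists>t\<in>I_set s d. y = path_sum s d X t)"

lemma I_setD:
  assumes "t \<in> I_set s d"
  shows "t \<in> extensional ({1..s} \<times> {0..d})"
    and "\<And>j l. 1 \<le> j \<Longrightarrow> j \<le> s \<Longrightarrow> l < j \<Longrightarrow> t (j, l) = 0"
    and "\<And>j l. 1 \<le> j \<Longrightarrow> j \<le> s \<Longrightarrow> d - s + j \<le> l \<Longrightarrow> l \<le> d \<Longrightarrow> t (j, l) = 1"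
    and "\<And>j l. 1 \<le> j \<Longrightarrow> j \<le> s \<Longrightarrow> Suc l \<le> d \<Longrightarrow> t (j, l) \<le> t (j, Suc l)"
    and "\<And>j l. 1 \<le> j \<Longrightarrow> Suc j \<le> s \<Longrightarrow> l < d \<Longrightarrow> t (Suc j, Suc l) \<le> t (j, l)"
proof -
  show "t \<in> extensional ({1..s} \<times> {0..d})" using assms by (simp add: I_set_def)
  show "\<And>j l. 1 \<le> j \<Longrightarrow> j \<le> s \<Longrightarrow> l < j \<Longrightarrow> t (j, l) = 0"
    using assms by (auto simp: I_set_def)
  show "\<And>j l. 1 \<le> j \<Longrightarrow> j \<le> s \<Longrightarrow> d - s + j \<le> l \<Longrightarrow> l \<le> d \<Longrightarrow> t (j, l) = 1"
    using assms by (auto simp: I_set_def)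
  show "t (j, l) \<le> t (j, Suc l)" if "1 \<le> j" "j \<le> s" "Suc l \<le> d" for j l
  proof -
    have "\<forall>j\<in>{1..s}. \<forall>l\<in>{1..d}. t (j, l - 1) \<le> t (j, l)"
      using assms by (simp add: I_set_def)
    from bspec[OF bspec[OF this, of j], of "Suc l"] that show ?thesis by simp
  qed
  show "\<And>j l. 1 \<le> j \<Longrightarrow> Suc j \<le> s \<Longrightarrow> l < d \<Longrightarrow> t (Suc j, Suc l) \<le> t (j, l)"
    using assms by (auto simp: I_set_def)
qed

lemma I_setI:
  assumes "t \<in> extensional ({1..s} \<times> {0..d})"
    and "\<And>j l. 1 \<le> j \<Longrightarrow> j \<le> s \<Longrightarrow> l < j \<Longrightarrow> t (j, l) = 0"
    and "\<And>j l. 1 \<le> j \<Longrightarrow> j \<le> s \<Longrightarrow> d - s + j \<le> l \<Longrightarrow> l \<le> d \<Longrightarrow> t (j, l) = 1"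
    and "\<And>j l. 1 \<le> j \<Longrightarrow> j \<le> s \<Longrightarrow> Suc l \<le> d \<Longrightarrow> t (j, l) \<le> t (j, Suc l)"
    and "\<And>j l. 1 \<le> j \<Longrightarrow> Suc j \<le> s \<Longrightarrow> l < d \<Longrightarrow> t (Suc j, Suc l) \<le> t (j, l)"
  shows "t \<in> I_set s d"
proof -
  have "t (j, l - 1) \<le> t (j, l)" if "j \<in> {1..s}" "l \<in> {1..d}" for j l
    using assms(4)[of j "l - 1"] that by simp
  moreover have "t (j, l) = 0" if "j \<in> {1..s}" "l \<in> {0..j - 1}" for j l
  proof -
    have "l < j" using that by auto
    then show ?thesis using assms(2)[of j l] that by simp
  qed
  ultimately show ?thesis using assms(1,3,5) by (simp add: I_set_def)
qed

lemma I_set_bounds: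
  assumes t: "t \<in> I_set s d" and "s \<le> d" "1 \<le> j" "j \<le> s" "l \<le> d"
  shows "0 \<le> t (j, l)" "t (j, l) \<le> 1"
proof -
  have mono: "t (j, a) \<le> t (j, b)" if "a \<le> b" "b \<le> d" for a b
    using that
  proof (induction b rule: dec_induct)
    case (step n)
    then show ?case using I_setD(4)[OF t, of j n] assms by simp
  qed simp
  show "0 \<le> t (j, l)" using mono[of 0 l] I_setD(2)[OF t, of j 0] assms by simp
  show "t (j, l) \<le> 1" using mono[of l d] I_setD(3)[OF t, of j d] assms by simp
qed

lemma I_set_nonempty: "I_set s d \<noteq> {}" if "s \<le> d"
proof -
  \<comment> \<open>Row \<open>j\<close> switches from 0 to 1 at column \<open>j\<close>, so path
    \<open>j\<close> spends the whole of \<open>[0, 1]\<close> at letter \<open>j\<close>.\<close>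
  have "restrict (\<lambda>(j, l). if l < j then 0 else 1) ({1..s} \<times> {0..d}) \<in> I_set s d"
    using that by (intro I_setI) auto
  then show ?thesis by blast
qed

text \<open>Coordinates off the index rectangle are frozen at \<open>undefined\<close>, so the set
  lies in a product, over all pairs of naturals, of unit intervals and singletons. This product is
  compact by Tychonoff's theorem, and every remaining condition is closed in the product
  topology.\<close>

lemma compact_I_set:
  assumes "s \<le> d"
  shows "compact (I_set s d)"
proof -
  let ?K = "{1..s} \<times> {0..d}"
  let ?Z = "PiE UNIV (\<lambda>p. if p \<in> ?K then {0..1} else {undefined}) :: (nat \<times> nat \<Rightarrow> real) set"
  have cont: "continuous_on UNIV (\<lambda>t::nat \<times> nat \<Rightarrow> real. t p)" for p
    by (rule continuous_on_product_coordinates)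
  have "compactin (product_topology (\<lambda>_. euclidean) UNIV) ?Z"
    by (subst compactin_PiE) auto
  then have Z: "compact ?Z"
    by (simp only: euclidean_product_topology compactin_euclidean_iff)
  let ?C = "(\<Inter>j\<in>{1..s}. \<Inter>l\<in>{0..j - 1}. {t. t (j, l) = 0}) \<inter>
     (\<Inter>j\<in>{1..s}. \<Inter>l\<in>{d - s + j..d}. {t. t (j, l) = 1}) \<inter>
     (\<Inter>j\<in>{1..s}. \<Inter>l\<in>{1..d}. {t. t (j, l - 1) \<le> t (j, l)}) \<inter>
     (\<Inter>j\<in>{1..<s}. \<Inter>l\<in>{0..<d}. {t. t (j + 1, l + 1) \<le> t (j, l)}) :: (nat \<times> nat \<Rightarrow> real) set"
  have "closed ?C"
    by (intro closed_Int closed_INT ballI closed_Collect_eq closed_Collect_le cont continuous_on_const)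
  moreover have "I_set s d = ?Z \<inter> ?C"
  proof
    show "I_set s d \<subseteq> ?Z \<inter> ?C"
    proof
      fix t assume t: "t \<in> I_set s d"
      have "t \<in> ?Z"
        using I_set_bounds[OF t assms] I_setD(1)[OF t] by (auto simp: extensional_def)
      then show "t \<in> ?Z \<inter> ?C" using t by (auto simp: I_set_def)
    qed
    show "?Z \<inter> ?C \<subseteq> I_set s d"
    proof
      fix t assume t: "t \<in> ?Z \<inter> ?C"
      have "t p = undefined" if "p \<notin> ?K" for p
        using PiE_mem[OF IntD1[OF t], of p] that by simp
      then have "t \<in> extensional ?K" by (simp add: extensional_def)
      then show "t \<in> I_set s d" using IntD2[OF t] unfolding I_set_def by fast
    qed
  qed
  ultimately show ?thesis using compact_Int_closed[OF Z, of ?C] by simp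
qed

text \<open>The entries of an array lie in \<open>[0, 1]\<close>, so continuity of the paths there
  makes \<open>path_sum\<close> continuous in the array; the domain is compact and nonempty. From
  here on the \<open>GREATEST\<close> is a genuine maximum.\<close>

lemma max_path_sum_attained:
  assumes "s \<le> d" and X: "\<And>l. l \<in> {1..d} \<Longrightarrow> continuous_on {0..1} (X l)"
  shows "\<exists>t\<in>I_set s d. max_path_sum s d X = path_sum s d X t \<and>
    (\<forall>u\<in>I_set s d. path_sum s d X u \<le> max_path_sum s d X)"
proof -
  have "continuous_on (I_set s d) (path_sum s d X)"
    unfolding path_sum_def
  proof (intro continuous_on_sum continuous_on_diff)
    fix j l assume jl: "j \<in> {1..s}" "l \<in> {j..d - s + j}"
    have "continuous_on (I_set s d) (\<lambda>t. X l (t (j, k)))" if k: "k \<le> d" for k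
    proof (rule continuous_on_compose2[of "{0..1}" "X l" _ "\<lambda>t. t (j, k)"])
      show "continuous_on {0..1} (X l)" by (rule X) (use jl assms(1) in auto)
      show "continuous_on (I_set s d) (\<lambda>t. t (j, k))"
        by (rule continuous_on_subset[OF continuous_on_product_coordinates]) simp
      show "(\<lambda>t. t (j, k)) ` I_set s d \<subseteq> {0..1}"
      proof (rule image_subsetI)
        fix t assume "t \<in> I_set s d"
        from I_set_bounds[OF this assms(1), of j k] jl k show "t (j, k) \<in> {0..1}" by simp
      qed
    qed
    note * = this
    have "l \<le> d" "l - 1 \<le> d" using jl assms(1) by auto
    from this[THEN *] show
      "continuous_on (I_set s d) (\<lambda>t. X l (t (j, l)))"
      "continuous_on (I_set s d) (\<lambda>t. X l (t (j, l - 1)))" .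
  qed
  from continuous_attains_sup[OF compact_I_set[OF assms(1)] I_set_nonempty[OF assms(1)] this]
  obtain t where t: "t \<in> I_set s d" "\<And>u. u \<in> I_set s d \<Longrightarrow> path_sum s d X u \<le> path_sum s d X t"
    by blast
  have "max_path_sum s d X = path_sum s d X t"
    unfolding max_path_sum_def by (rule Greatest_equality) (use t in auto)
  then show ?thesis using t by auto
qed

text \<open>Summation by parts. Row \<open>j\<close> starts at letter \<open>j\<close>, ends at
  letter \<open>d - s + j\<close>, and makes its \<open>i\<close>-th jump, from letter
  \<open>i + j - 1\<close> to \<open>i + j\<close>, at time \<open>t (j, i + j - 1)\<close>. The
  letters of a jump are symmetric in \<open>i\<close> and \<open>j\<close>, so rows and jump numbers
  can trade places; in this form an array is compared with its complement.\<close>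

lemma path_sum_jumps:
  assumes t: "t \<in> I_set s d" and sd: "s \<le> d" and X0: "\<And>l. l \<in> {1..d} \<Longrightarrow> X l 0 = 0"
  shows "path_sum s d X t = (\<Sum>j=1..s. X (d - s + j) 1) +
    (\<Sum>j=1..s. \<Sum>i=1..d - s. X (i + j - 1) (t (j, i + j - 1)) - X (i + j) (t (j, i + j - 1)))"
  unfolding path_sum_def sum.distrib[symmetric]
proof (rule sum.cong[OF refl])
  fix j assume j: "j \<in> {1..s}"
  let ?n = "d - s"
  have "(\<Sum>l=j..?n + j. X l (t (j, l)) - X l (t (j, l - 1))) =
    (\<Sum>i=0..?n. X (i + j) (t (j, i + j)) - X (i + j) (t (j, i + j - 1)))"
    using sum.shift_bounds_cl_nat_ivl[of "\<lambda>l. X l (t (j, l)) - X l (t (j, l - 1))" 0 j ?n] by simp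
  also have "\<dots> = (\<Sum>i=0..?n. X (i + j) (t (j, i + j))) - (\<Sum>i=0..?n. X (i + j) (t (j, i + j - 1)))"
    by (rule sum_subtractf)
  also have "(\<Sum>i=0..?n. X (i + j) (t (j, i + j - 1))) =
      X j (t (j, j - 1)) + (\<Sum>i=1..?n. X (i + j) (t (j, i + j - 1)))"
    by (subst sum.atLeast_Suc_atMost) auto
  also have "X j (t (j, j - 1)) = 0"
    using I_setD(2)[OF t, of j "j - 1"] j X0[of j] sd by simp
  also have "(\<Sum>i=0..?n. X (i + j) (t (j, i + j))) =
      (\<Sum>i=1..?n. X (i + j - 1) (t (j, i + j - 1))) + X (?n + j) (t (j, ?n + j))"
  proof (cases ?n)
    case (Suc k)
    show ?thesis unfolding Suc
      using sum.shift_bounds_cl_Suc_ivl[of "\<lambda>i. X (i + j - 1) (t (j, i + j - 1))" 0 k]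
      by simp
  qed simp
  also have "t (j, ?n + j) = 1"
    by (rule I_setD(3)[OF t]) (use j sd in auto)
  finally show "(\<Sum>l=j..?n + j. X l (t (j, l)) - X l (t (j, l - 1))) = X (?n + j) 1 +
    (\<Sum>i=1..?n. X (i + j - 1) (t (j, i + j - 1)) - X (i + j) (t (j, i + j - 1)))"
    by (simp add: sum_subtractf)
qed

text \<open>Subtracting \<open>X l 1\<close> makes the reversed path start at 0. On paths that
  themselves start at 0 the operation undoes itself.\<close>

definition reversed :: "(nat \<Rightarrow> real \<Rightarrow> real) \<Rightarrow> nat \<Rightarrow> real \<Rightarrow> real" where
  "reversed X l x = X l (1 - x) - X l 1"

text \<open>Complementation exchanges the two kinds of monotonicity: along a row of \<open>u\<close>
  the entries of \<open>t\<close> run down a diagonal, along a diagonal of \<open>u\<close> they run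
  along a row, and \<open>1 - _\<close> turns the order round. For the values, jump \<open>j\<close>
  of row \<open>i\<close> of \<open>u\<close> is jump \<open>i\<close> of row \<open>j\<close> of
  \<open>t\<close>, seen in reversed time.\<close>

lemma complementary_array:
  assumes t: "t \<in> I_set s d" and sd: "s \<le> d" and X0: "\<And>l. l \<in> {1..d} \<Longrightarrow> X l 0 = 0"
  obtains u where "u \<in> I_set (d - s) d"
    "path_sum (d - s) d (reversed X) u = path_sum s d X t - (\<Sum>l=1..d. X l 1)"
proof
  let ?n = "d - s" and ?K = "{1..d - s} \<times> {0..d}"
  \<comment> \<open>The two constant cases are where \<open>Suc l - i\<close> leaves the range
    \<open>{1..s}\<close> of rows of \<open>t\<close>.\<close>
  define u where "u = restrict (\<lambda>(i, l). if l < i then 0 else if s + i \<le> l then 1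
    else 1 - t (Suc l - i, l)) ?K"
  have dn: "d - ?n = s" using sd by simp
  have u_in: "u (i, l) = 1 - t (Suc l - i, l)" if "1 \<le> i" "i \<le> ?n" "i \<le> l" "l < s + i" for i l
    using that unfolding u_def by auto
  have u0: "u (i, l) = 0" if "1 \<le> i" "i \<le> ?n" "l < i" for i l
    using that unfolding u_def by auto
  have u1: "u (i, l) = 1" if "1 \<le> i" "i \<le> ?n" "s + i \<le> l" "l \<le> d" for i l
    using that unfolding u_def by auto
  note tb = I_set_bounds[OF t sd]
  have ub: "0 \<le> u (i, l) \<and> u (i, l) \<le> 1" if "1 \<le> i" "i \<le> ?n" "l \<le> d" for i l
  proof -
    consider "l < i" | "i \<le> l" "l < s + i" | "s + i \<le> l" by linarith
    then show ?thesis
    proof cases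
      case 2
      have "1 \<le> Suc l - i" "Suc l - i \<le> s" using that 2 by auto
      from tb[OF this \<open>l \<le> d\<close>] show ?thesis using u_in[OF that(1,2) 2] by simp
    qed (use u0[OF that(1,2)] u1[OF that(1,2)] that(3) in auto)
  qed
  show mem: "u \<in> I_set ?n d"
  proof (rule I_setI)
    show "u \<in> extensional ?K" unfolding u_def by simp
    show "u (i, l) = 0" if "1 \<le> i" "i \<le> ?n" "l < i" for i l
      using u0 that by simp
    show "u (i, l) = 1" if "1 \<le> i" "i \<le> ?n" "d - ?n + i \<le> l" "l \<le> d" for i l
      using u1 that dn by simp
    show "u (i, l) \<le> u (i, Suc l)" if i: "1 \<le> i" "i \<le> ?n" "Suc l \<le> d" for i l
    proof (cases "i \<le> l \<and> Suc l < s + i")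
      case True
      have "t (Suc (Suc l - i), Suc l) \<le> t (Suc l - i, l)"
        by (rule I_setD(5)[OF t]) (use True i in auto)
      then show ?thesis using u_in[of i l] u_in[of i "Suc l"] True i by (simp add: Suc_diff_le)
    next
      case False
      then show ?thesis using u0[of i l] u1[of i "Suc l"] ub[of i l] ub[of i "Suc l"] i
        by (cases "l < i") auto
    qed
    show "u (Suc i, Suc l) \<le> u (i, l)" if i: "1 \<le> i" "Suc i \<le> ?n" "l < d" for i l
    proof (cases "i \<le> l \<and> l < s + i")
      case True
      have "t (Suc l - i, l) \<le> t (Suc l - i, Suc l)"
        by (rule I_setD(4)[OF t]) (use True i in auto)
      then show ?thesis using u_in[of i l] u_in[of "Suc i" "Suc l"] True i by simp
    next
      case False
      then show ?thesis using u0[of "Suc i" "Suc l"] u1[of i l] ub[of i l] ub[of "Suc i" "Suc l"] i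
        by (cases "l < i") auto
    qed
  qed
  define f where "f l = X l 1" for l
  define G where "G i j = X (i + j - 1) (t (j, i + j - 1)) - X (i + j) (t (j, i + j - 1))" for i j
  have "path_sum ?n d (reversed X) u = (\<Sum>i=1..?n. reversed X (d - ?n + i) 1) +
    (\<Sum>i=1..?n. \<Sum>j=1..d - ?n. reversed X (j + i - 1) (u (i, j + i - 1)) - reversed X (j + i) (u (i, j + i - 1)))"
    by (rule path_sum_jumps[OF mem]) (auto simp: reversed_def X0)
  also have "\<dots> = (\<Sum>i=1..?n. - f (s + i)) + (\<Sum>i=1..?n. \<Sum>j=1..s. G i j - (f (i + j - 1) - f (i + j)))"
  proof (unfold dn, intro arg_cong2[where f="(+)"] sum.cong refl)
    fix i assume i: "i \<in> {1..?n}"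
    then show "reversed X (s + i) 1 = - f (s + i)"
      using X0[of "s + i"] sd by (auto simp: reversed_def f_def)
    fix j assume j: "j \<in> {1..s}"
    have "u (i, j + i - 1) = 1 - t (j, i + j - 1)"
    proof -
      have "u (i, j + i - 1) = 1 - t (Suc (j + i - 1) - i, j + i - 1)"
        by (rule u_in) (use i j in auto)
      moreover have "Suc (j + i - 1) - i = j" "j + i - 1 = i + j - 1" using i j by auto
      ultimately show ?thesis by metis
    qed
    then show "reversed X (j + i - 1) (u (i, j + i - 1)) - reversed X (j + i) (u (i, j + i - 1)) =
      G i j - (f (i + j - 1) - f (i + j))"
      by (simp add: reversed_def G_def f_def add.commute)
  qed
  \<comment> \<open>Each jump also carries a difference of endpoints, left by the subtraction in
    \<open>reversed\<close>. Over the jumps of row \<open>i\<close> these telescope to its first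
    letter \<open>i\<close> and its last letter \<open>i + s\<close>.\<close>
  also have "(\<Sum>i=1..?n. \<Sum>j=1..s. G i j - (f (i + j - 1) - f (i + j))) =
      (\<Sum>i=1..?n. (\<Sum>j=1..s. G i j) - (f i - f (i + s)))"
  proof (rule sum.cong[OF refl])
    fix i assume i: "i \<in> {1..?n}"
    have "(\<Sum>j=1..s. f (i + j - 1) - f (i + j)) = f i - f (i + s)"
      by (induction s) auto
    then show "(\<Sum>j=1..s. G i j - (f (i + j - 1) - f (i + j))) = (\<Sum>j=1..s. G i j) - (f i - f (i + s))"
      by (simp add: sum_subtractf)
  qed
  \<comment> \<open>The last letters cancel against the final values of the rows of
    \<open>u\<close>. The endpoints of letters \<open>1..d - s\<close> remain, and the final values
    of the rows of \<open>t\<close> will supply those of the other \<open>s\<close> letters.\<close>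
  also have "(\<Sum>i=1..?n. - f (s + i)) + \<dots> = (\<Sum>i=1..?n. \<Sum>j=1..s. G i j) - (\<Sum>i=1..?n. f i)"
    by (simp add: sum_subtractf sum_negf add.commute)
  also have "(\<Sum>i=1..?n. \<Sum>j=1..s. G i j) = (\<Sum>j=1..s. \<Sum>i=1..?n. G i j)"
    by (rule sum.swap)
  also have "\<dots> = path_sum s d X t - (\<Sum>j=1..s. f (?n + j))"
    using path_sum_jumps[of t s d X, OF t sd X0] by (simp add: G_def f_def)
  also have "(\<Sum>j=1..s. f (?n + j)) = (\<Sum>l=Suc ?n..d. f l)"
    using sum.shift_bounds_cl_nat_ivl[of f 1 ?n s] sd by (simp add: add.commute)
  also have "path_sum s d X t - (\<Sum>l=Suc ?n..d. f l) - (\<Sum>i=1..?n. f i) = path_sum s d X t - (\<Sum>l=1..d. f l)"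
    using sum.ub_add_nat[of 1 ?n f s] sd by simp
  finally show "path_sum ?n d (reversed X) u = path_sum s d X t - (\<Sum>l=1..d. X l 1)"
    by (simp add: f_def)
qed

lemma continuous_on_reversed:
  assumes "continuous_on {0..1} (X l)"
  shows "continuous_on {0..1} (reversed X l)"
  unfolding reversed_def
  by (intro continuous_intros continuous_on_compose2[OF assms]) auto

lemma path_sum_cong:
  assumes "s \<le> d" "t \<in> I_set s d" "\<And>l x. l \<in> {1..d} \<Longrightarrow> x \<in> {0..1} \<Longrightarrow> X l x = Y l x"
  shows "path_sum s d X t = path_sum s d Y t"
  unfolding path_sum_def
proof (intro sum.cong refl)
  fix j l assume jl: "j \<in> {1..s}" "l \<in> {j..d - s + j}"
  have "X l (t (j, k)) = Y l (t (j, k))" if "k \<le> d" for k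
    using assms(3)[of l "t (j, k)"] I_set_bounds[OF assms(2,1), of j k] jl that assms(1) by auto
  from this[of l] this[of "l - 1"] jl assms(1)
  show "X l (t (j, l)) - X l (t (j, l - 1)) = Y l (t (j, l)) - Y l (t (j, l - 1))" by auto
qed

text \<open>A maximising array on either side has a complement on the other side, and each gives one
  inequality, so complementation need not be shown bijective. The second complement, of
  \<open>u\<close> for \<open>reversed X\<close>, returns to \<open>I_set s d\<close> because
  \<open>d - (d - s) = s\<close>, and to \<open>X\<close> because reversing twice restores paths
  that start at 0.\<close>

lemma max_path_sum_reversed:
  assumes sd: "s \<le> d" and X0: "\<And>l. l \<in> {1..d} \<Longrightarrow> X l 0 = 0"
    and X: "\<And>l. l \<in> {1..d} \<Longrightarrow> continuous_on {0..1} (X l)"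
  shows "max_path_sum (d - s) d (reversed X) = max_path_sum s d X - (\<Sum>l=1..d. X l 1)"
proof (rule antisym)
  note rc = continuous_on_reversed[OF X]
  obtain t where t: "t \<in> I_set s d" "max_path_sum s d X = path_sum s d X t"
    and le: "\<And>t. t \<in> I_set s d \<Longrightarrow> path_sum s d X t \<le> max_path_sum s d X"
    using max_path_sum_attained[of s d X, OF sd X] by blast
  obtain u where u: "u \<in> I_set (d - s) d"
      "max_path_sum (d - s) d (reversed X) = path_sum (d - s) d (reversed X) u"
    and le': "\<And>u. u \<in> I_set (d - s) d \<Longrightarrow>
      path_sum (d - s) d (reversed X) u \<le> max_path_sum (d - s) d (reversed X)"
    using max_path_sum_attained[of "d - s" d "reversed X", OF diff_le_self rc] by blast
  show "max_path_sum s d X - (\<Sum>l=1..d. X l 1) \<le> max_path_sum (d - s) d (reversed X)"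
  proof (rule complementary_array[of t s d X, OF t(1) sd X0])
    fix u' assume "u' \<in> I_set (d - s) d"
      "path_sum (d - s) d (reversed X) u' = path_sum s d X t - (\<Sum>l=1..d. X l 1)"
    then show ?thesis using le'[of u'] t(2) by simp
  qed
  have "\<And>l. l \<in> {1..d} \<Longrightarrow> reversed X l 0 = 0" by (simp add: reversed_def)
  from complementary_array[of u "d - s" d "reversed X", OF u(1) diff_le_self this] sd
  obtain t' where t': "t' \<in> I_set s d"
    "path_sum s d (reversed (reversed X)) t' = path_sum (d - s) d (reversed X) u - (\<Sum>l=1..d. reversed X l 1)"
    by (auto simp: diff_diff_cancel)
  have "path_sum s d (reversed (reversed X)) t' = path_sum s d X t'"
    by (rule path_sum_cong[OF sd t'(1)]) (simp add: reversed_def X0)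
  moreover have "(\<Sum>l=1..d. reversed X l 1) = - (\<Sum>l=1..d. X l 1)"
    by (simp add: reversed_def X0 sum_negf)
  ultimately show "max_path_sum (d - s) d (reversed X) \<le> max_path_sum s d X - (\<Sum>l=1..d. X l 1)"
    using u(2) t'(2) le[OF t'(1)] by simp
qed

section \<open>Approximation of the maximum on finite grids\<close>

definition grid_arrays :: "nat \<Rightarrow> nat \<Rightarrow> nat \<Rightarrow> (nat \<times> nat \<Rightarrow> real) set" where
  "grid_arrays N s d = {t \<in> I_set s d. \<forall>p\<in>{1..s} \<times> {0..d}. \<exists>q\<le>N. t p = real q / real N}"

lemma finite_grid_arrays: "finite (grid_arrays N s d)"
proof (rule finite_subset)
  show "grid_arrays N s d \<subseteq> PiE ({1..s} \<times> {0..d}) (\<lambda>_. (\<lambda>q. real q / real N) ` {..N})"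
  proof
    fix t assume t: "t \<in> grid_arrays N s d"
    show "t \<in> PiE ({1..s} \<times> {0..d}) (\<lambda>_. (\<lambda>q. real q / real N) ` {..N})"
    proof (rule PiE_I)
      fix p assume "p \<in> {1..s} \<times> {0..d}"
      then obtain q where "q \<le> N" "t p = real q / real N" using t unfolding grid_arrays_def by blast
      then show "t p \<in> (\<lambda>q. real q / real N) ` {..N}" by blast
    next
      fix p assume "p \<notin> {1..s} \<times> {0..d}"
      moreover have "t \<in> extensional ({1..s} \<times> {0..d})"
        using t I_setD(1) unfolding grid_arrays_def by blast
      ultimately show "t p = undefined" by (rule extensional_arb[rotated])
    qed
  qed
qed (intro finite_PiE, auto)

text \<open>Rounding every entry down to a multiple of \<open>1 / Suc N\<close> keeps all conditions
  of \<open>I_set\<close>: the floor is monotone, and the prescribed entries 0 and 1 are already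
  grid points. The error is at most the mesh.\<close>

lemma grid_approximation:
  assumes t: "t \<in> I_set s d" and sd: "s \<le> d"
  obtains g where "\<And>N. g N \<in> grid_arrays (Suc N) s d"
    "\<And>j l. j \<in> {1..s} \<Longrightarrow> l \<le> d \<Longrightarrow> (\<lambda>N. g N (j, l)) \<longlonglongrightarrow> t (j, l)"
proof
  define g where "g N = restrict (\<lambda>p. real_of_int \<lfloor>real (Suc N) * t p\<rfloor> / real (Suc N)) ({1..s} \<times> {0..d})" for N
  note tb = I_set_bounds[OF t sd]
  have gv: "g N (j, l) = real_of_int \<lfloor>real (Suc N) * t (j, l)\<rfloor> / real (Suc N)"
    if "1 \<le> j" "j \<le> s" "l \<le> d" for N j l
    using that by (simp add: g_def)
  have mono: "g N (j, l) \<le> g N (j', l')"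
    if "1 \<le> j" "j \<le> s" "l \<le> d" "1 \<le> j'" "j' \<le> s" "l' \<le> d" "t (j, l) \<le> t (j', l')" for N j l j' l'
  proof -
    have "real (Suc N) * t (j, l) \<le> real (Suc N) * t (j', l')"
      using that(7) by (rule mult_left_mono) simp
    then have "real_of_int \<lfloor>real (Suc N) * t (j, l)\<rfloor> \<le> real_of_int \<lfloor>real (Suc N) * t (j', l')\<rfloor>"
      using floor_mono by (simp only: of_int_le_iff)
    then show ?thesis
      unfolding gv[OF that(1-3)] gv[OF that(4-6)] by (rule divide_right_mono) simp
  qed
  show "g N \<in> grid_arrays (Suc N) s d" for N
    unfolding grid_arrays_def
  proof (intro CollectI conjI ballI)
    show "g N \<in> I_set s d"
    proof (rule I_setI)
      show "g N \<in> extensional ({1..s} \<times> {0..d})" by (simp add: g_def)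
      show "g N (j, l) = 0" if "1 \<le> j" "j \<le> s" "l < j" for j l
        using gv[of j l N] I_setD(2)[OF t, of j l] that sd by simp
      show "g N (j, l) = 1" if "1 \<le> j" "j \<le> s" "d - s + j \<le> l" "l \<le> d" for j l
        using gv[of j l N] I_setD(3)[OF t, of j l] that sd by simp
      show "g N (j, l) \<le> g N (j, Suc l)" if "1 \<le> j" "j \<le> s" "Suc l \<le> d" for j l
        by (rule mono[OF _ _ _ _ _ _ I_setD(4)[OF t]]) (use that in auto)
      show "g N (Suc j, Suc l) \<le> g N (j, l)" if "1 \<le> j" "Suc j \<le> s" "l < d" for j l
        by (rule mono[OF _ _ _ _ _ _ I_setD(5)[OF t]]) (use that in auto)
    qed
    fix p assume "p \<in> {1..s} \<times> {0..d}"
    then obtain j l where p: "p = (j, l)" "1 \<le> j" "j \<le> s" "l \<le> d" by auto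
    let ?q = "\<lfloor>real (Suc N) * t (j, l)\<rfloor>"
    have "0 \<le> ?q" using tb(1)[OF p(2-4)] by simp
    moreover have "real (Suc N) * t (j, l) \<le> real (Suc N)"
      using mult_left_mono[OF tb(2)[OF p(2-4)], of "real (Suc N)"] by simp
    then have "?q \<le> \<lfloor>real (Suc N)\<rfloor>" by (rule floor_mono)
    then have "?q \<le> int (Suc N)" by (simp only: floor_of_nat)
    ultimately show "\<exists>q\<le>Suc N. g N p = real q / real (Suc N)"
      unfolding p(1) gv[OF p(2-4)] by (intro exI[of _ "nat ?q"]) (simp del: of_nat_Suc)
  qed
  fix j l assume jl: "j \<in> {1..s}" "l \<le> d"
  have *: "\<bar>g N (j, l) - t (j, l)\<bar> \<le> inverse (real (Suc N))" for N
  proof -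
    let ?x = "real (Suc N) * t (j, l)"
    have "g N (j, l) - t (j, l) = (real_of_int \<lfloor>?x\<rfloor> - ?x) / real (Suc N)"
      using jl by (simp add: gv diff_divide_distrib del: of_nat_Suc)
    also have "\<bar>\<dots>\<bar> \<le> 1 / real (Suc N)"
    proof -
      have "\<bar>real_of_int \<lfloor>y\<rfloor> - y\<bar> \<le> 1" for y by linarith
      from this[of ?x] have "\<bar>real_of_int \<lfloor>?x\<rfloor> - ?x\<bar> \<le> 1" .
      then show ?thesis unfolding abs_divide by (simp add: divide_right_mono del: of_nat_Suc)
    qed
    finally show ?thesis by (simp add: inverse_eq_divide)
  qed
  show "(\<lambda>N. g N (j, l)) \<longlonglongrightarrow> t (j, l)"
  proof (rule LIM_zero_cancel, rule Lim_null_comparison[OF _ LIMSEQ_inverse_real_of_nat])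
    show "\<forall>\<^sub>F N in sequentially. norm (g N (j, l) - t (j, l)) \<le> inverse (real (Suc N))"
      using * by simp
  qed
qed

text \<open>Grid arrays are arrays, so the grid maximum never exceeds the true one. It is at least
  the value at the rounding of one maximising array, and this value converges because the paths are
  continuous. No rate or uniform estimate is involved.\<close>

lemma max_path_sum_grid_limit:
  assumes sd: "s \<le> d" and X: "\<And>l. l \<in> {1..d} \<Longrightarrow> continuous_on {0..1} (X l)"
  shows "(\<lambda>N. Max (path_sum s d X ` grid_arrays (Suc N) s d)) \<longlonglongrightarrow> max_path_sum s d X"
proof -
  obtain t where t: "t \<in> I_set s d" "max_path_sum s d X = path_sum s d X t"
    and le: "\<And>u. u \<in> I_set s d \<Longrightarrow> path_sum s d X u \<le> max_path_sum s d X"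
    using max_path_sum_attained[of s d X, OF sd X] by blast
  obtain g where g: "\<And>N. g N \<in> grid_arrays (Suc N) s d"
    "\<And>j l. j \<in> {1..s} \<Longrightarrow> l \<le> d \<Longrightarrow> (\<lambda>N. g N (j, l)) \<longlonglongrightarrow> t (j, l)"
    using grid_approximation[OF t(1) sd] by metis
  have gI: "g N \<in> I_set s d" for N using g(1) by (simp add: grid_arrays_def)
  have lim: "(\<lambda>N. path_sum s d X (g N)) \<longlonglongrightarrow> path_sum s d X t"
    unfolding path_sum_def
  proof (intro tendsto_sum tendsto_diff)
    fix j l assume jl: "j \<in> {1..s}" "l \<in> {j..d - s + j}"
    have "(\<lambda>N. X l (g N (j, k))) \<longlonglongrightarrow> X l (t (j, k))" if "k \<le> d" for k
    proof (rule continuous_on_tendsto_compose[OF X g(2)])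
      show "l \<in> {1..d}" "j \<in> {1..s}" "k \<le> d" using jl sd that by auto
      show "t (j, k) \<in> {0..1}" using I_set_bounds[OF t(1) sd, of j k] jl that by simp
      show "\<forall>\<^sub>F N in sequentially. g N (j, k) \<in> {0..1}"
        using I_set_bounds[OF gI sd, of j k] jl that by simp
    qed
    note * = this
    have "l \<le> d" "l - 1 \<le> d" using jl sd by auto
    from this[THEN *] show "(\<lambda>N. X l (g N (j, l))) \<longlonglongrightarrow> X l (t (j, l))"
      "(\<lambda>N. X l (g N (j, l - 1))) \<longlonglongrightarrow> X l (t (j, l - 1))" .
  qed
  show ?thesis
  proof (rule tendsto_sandwich[OF _ _ lim[folded t(2)] tendsto_const])
    show "\<forall>\<^sub>F N in sequentially. path_sum s d X (g N) \<le> Max (path_sum s d X ` grid_arrays (Suc N) s d)"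
      using g(1) finite_grid_arrays by (intro always_eventually allI Max_ge) auto
    show "\<forall>\<^sub>F N in sequentially. Max (path_sum s d X ` grid_arrays (Suc N) s d) \<le> max_path_sum s d X"
    proof (intro always_eventually allI Max.boundedI)
      fix N y assume "y \<in> path_sum s d X ` grid_arrays (Suc N) s d"
      then show "y \<le> max_path_sum s d X" using le unfolding grid_arrays_def by blast
    next
      show "path_sum s d X ` grid_arrays (Suc N) s d \<noteq> {}" for N using g(1) by blast
    qed (rule finite_imageI[OF finite_grid_arrays])
  qed
qed

section \<open>The Cramer--Wold device\<close>

lemma char_distr:
  assumes "X \<in> borel_measurable M"
  shows "char (distr M borel X) t = (CLINT x|M. iexp (t * X x))"
  unfolding char_def using assms by (subst integral_distr) auto

lemma real_distributionI_distr:
  assumes "prob_space M" "X \<in> borel_measurable M"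
  shows "real_distribution (distr M borel X)"
  using assms by (simp add: real_distribution_def real_distribution_axioms_def prob_space.prob_space_distr)

lemma distr_eqI_char:
  assumes "prob_space M" "prob_space N" "X \<in> borel_measurable M" "Y \<in> borel_measurable N"
    and "\<And>t. (CLINT x|M. iexp (t * X x)) = (CLINT x|N. iexp (t * Y x))"
  shows "distr M borel X = distr N borel Y"
  by (rule Levy_uniqueness)
    (use assms in \<open>auto intro!: real_distributionI_distr simp: char_distr fun_eq_iff\<close>)

text \<open>Dividing by the total mass turns the weights into probability densities, and Levy's
  uniqueness theorem applies to the reweighted laws. The case \<open>t = 0\<close> shows that the
  masses agree. The bounds 1 and 3 are those of a weight in \<open>[-1, 1]\<close> shifted by 2; the
  lower one keeps the mass away from 0.\<close>

lemma positive_weight_uniqueness: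
  fixes w :: "'a \<Rightarrow> real" and v :: "'b \<Rightarrow> real"
  assumes M: "prob_space M" and N: "prob_space N"
    and X[measurable]: "X \<in> borel_measurable M" and Y[measurable]: "Y \<in> borel_measurable N"
    and w[measurable]: "w \<in> borel_measurable M" and v[measurable]: "v \<in> borel_measurable N"
    and wb: "\<And>x. 1 \<le> w x" "\<And>x. w x \<le> 3" and vb: "\<And>x. 1 \<le> v x" "\<And>x. v x \<le> 3"
    and eq: "\<And>t. (CLINT x|M. complex_of_real (w x) * iexp (t * X x)) =
      (CLINT x|N. complex_of_real (v x) * iexp (t * Y x))"
    and A[measurable]: "A \<in> sets borel"
  shows "(LINT x|M. w x * indicator A (X x)) = (LINT x|N. v x * indicator A (Y x))"
proof -
  interpret M: prob_space M by fact
  interpret N: prob_space N by fact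
  have "norm (w x) \<le> 3" for x using wb(1)[of x] wb(2)[of x] by simp
  then have iw: "integrable M w" by (intro M.integrable_const_bound[of _ 3] AE_I2) auto
  have "norm (v x) \<le> 3" for x using vb(1)[of x] vb(2)[of x] by simp
  then have iv: "integrable N v" by (intro N.integrable_const_bound[of _ 3] AE_I2) auto
  define c where "c = (LINT x|M. w x)"
  have c': "c = (LINT x|N. v x)" using eq[of 0] unfolding c_def by simp
  have c: "c \<ge> 1"
    unfolding c_def using integral_mono[of M "\<lambda>_. 1" w] iw wb M.prob_space by simp
  define DM where "DM = density M (\<lambda>x. ennreal (w x / c))"
  define DN where "DN = density N (\<lambda>x. ennreal (v x / c))"
  have w0: "0 \<le> w x / c" for x using wb(1)[of x] c by simp
  have v0: "0 \<le> v x / c" for x using vb(1)[of x] c by simp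
  have DM: "prob_space DM"
  proof
    have "emeasure DM (space DM) = (\<integral>\<^sup>+ x. ennreal (w x / c) \<partial>M)"
      unfolding DM_def by (subst emeasure_density) (auto intro!: nn_integral_cong)
    also have "\<dots> = ennreal (LINT x|M. w x / c)"
      using iw w0 by (intro nn_integral_eq_integral) auto
    finally show "emeasure DM (space DM) = 1" using c by (simp add: c_def[symmetric])
  qed
  have DN: "prob_space DN"
  proof
    have "emeasure DN (space DN) = (\<integral>\<^sup>+ x. ennreal (v x / c) \<partial>N)"
      unfolding DN_def by (subst emeasure_density) (auto intro!: nn_integral_cong)
    also have "\<dots> = ennreal (LINT x|N. v x / c)"
      using iv v0 by (intro nn_integral_eq_integral) auto
    finally show "emeasure DN (space DN) = 1" using c by (simp add: c'[symmetric])
  qed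
  have XD[measurable]: "X \<in> borel_measurable DM" "Y \<in> borel_measurable DN"
    unfolding DM_def DN_def by auto
  have "distr DM borel X = distr DN borel Y"
  proof (rule distr_eqI_char[OF DM DN XD])
    fix t
    have "(CLINT x|DM. iexp (t * X x)) = (CLINT x|M. (w x / c) *\<^sub>R iexp (t * X x))"
      unfolding DM_def using w0 by (intro integral_density) auto
    also have "\<dots> = (CLINT x|M. complex_of_real (w x) * iexp (t * X x)) / complex_of_real c"
      by (simp add: scaleR_conv_of_real flip: integral_divide_zero)
    also have "\<dots> = (CLINT x|N. complex_of_real (v x) * iexp (t * Y x)) / complex_of_real c"
      by (simp only: eq)
    also have "\<dots> = (CLINT x|N. (v x / c) *\<^sub>R iexp (t * Y x))"
      by (simp add: scaleR_conv_of_real flip: integral_divide_zero)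
    also have "\<dots> = (CLINT x|DN. iexp (t * Y x))"
      unfolding DN_def using v0 by (intro integral_density[symmetric]) auto
    finally show "(CLINT x|DM. iexp (t * X x)) = (CLINT x|DN. iexp (t * Y x))" .
  qed
  then have "(LINT y|distr DM borel X. indicator A y :: real) = (LINT y|distr DN borel Y. indicator A y)"
    by simp
  moreover have "(LINT y|distr DM borel X. indicator A y) = (LINT x|M. w x * indicator A (X x)) / c"
  proof -
    have "(LINT y|distr DM borel X. indicator A y) = (LINT x|DM. indicator A (X x) :: real)"
      by (rule integral_distr) auto
    also have "\<dots> = (LINT x|M. (w x / c) *\<^sub>R indicator A (X x))"
      unfolding DM_def using w0 by (intro integral_density) auto
    finally show ?thesis by simp
  qed
  moreover have "(LINT y|distr DN borel Y. indicator A y) = (LINT x|N. v x * indicator A (Y x)) / c"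
  proof -
    have "(LINT y|distr DN borel Y. indicator A y) = (LINT x|DN. indicator A (Y x) :: real)"
      by (rule integral_distr) auto
    also have "\<dots> = (LINT x|N. (v x / c) *\<^sub>R indicator A (Y x))"
      unfolding DN_def using v0 by (intro integral_density) auto
    finally show ?thesis by simp
  qed
  ultimately show ?thesis using c by simp
qed

text \<open>A signed weight becomes positive by adding 2. The added part contributes twice the
  unweighted integral, on which both sides agree by the positive case with weight 1.\<close>

lemma real_weight_uniqueness:
  fixes w :: "'a \<Rightarrow> real" and v :: "'b \<Rightarrow> real"
  assumes M: "prob_space M" and N: "prob_space N"
    and X[measurable]: "X \<in> borel_measurable M" and Y[measurable]: "Y \<in> borel_measurable N"
    and w[measurable]: "w \<in> borel_measurable M" and v[measurable]: "v \<in> borel_measurable N"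
    and wb: "\<And>x. \<bar>w x\<bar> \<le> 1" and vb: "\<And>x. \<bar>v x\<bar> \<le> 1"
    and eq: "\<And>t. (CLINT x|M. complex_of_real (w x) * iexp (t * X x)) =
      (CLINT x|N. complex_of_real (v x) * iexp (t * Y x))"
    and eq1: "\<And>t. (CLINT x|M. iexp (t * X x)) = (CLINT x|N. iexp (t * Y x))"
    and A[measurable]: "A \<in> sets borel"
  shows "(LINT x|M. w x * indicator A (X x)) = (LINT x|N. v x * indicator A (Y x))"
proof -
  interpret M: prob_space M by fact
  interpret N: prob_space N by fact
  have iM: "integrable M (\<lambda>x. complex_of_real (w x) * iexp (t * X x))" "integrable M (\<lambda>x. iexp (t * X x))" for t
    using wb by (auto intro!: M.integrable_const_bound[of _ 1] simp: norm_mult)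
  have iN: "integrable N (\<lambda>x. complex_of_real (v x) * iexp (t * Y x))" "integrable N (\<lambda>x. iexp (t * Y x))" for t
    using vb by (auto intro!: N.integrable_const_bound[of _ 1] simp: norm_mult)
  have jM: "integrable M (\<lambda>x. w x * indicator A (X x))" "integrable M (\<lambda>x. indicator A (X x) :: real)"
    using wb by (auto intro!: M.integrable_const_bound[of _ 1] simp: abs_mult indicator_def)
  have jN: "integrable N (\<lambda>x. v x * indicator A (Y x))" "integrable N (\<lambda>x. indicator A (Y x) :: real)"
    using vb by (auto intro!: N.integrable_const_bound[of _ 1] simp: abs_mult indicator_def)
  have wb': "- 1 \<le> w x" "w x \<le> 1" for x using wb[of x] by auto
  have vb': "- 1 \<le> v x" "v x \<le> 1" for x using vb[of x] by auto
  have "(LINT x|M. (2 + w x) * indicator A (X x)) = (LINT x|N. (2 + v x) * indicator A (Y x))"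
  proof (rule positive_weight_uniqueness[OF M N X Y _ _ _ _ _ _ _ A])
    show "1 \<le> 2 + w x" "2 + w x \<le> 3" for x using wb'[of x] by auto
    show "1 \<le> 2 + v x" "2 + v x \<le> 3" for x using vb'[of x] by auto
    fix t show "(CLINT x|M. complex_of_real (2 + w x) * iexp (t * X x)) =
      (CLINT x|N. complex_of_real (2 + v x) * iexp (t * Y x))"
      using iM[of t] iN[of t] eq[of t] eq1[of t] by (simp add: distrib_right)
  qed auto
  moreover have "(LINT x|M. 1 * indicator A (X x)) = (LINT x|N. 1 * indicator A (Y x) :: real)"
    by (rule positive_weight_uniqueness[OF M N X Y _ _ _ _ _ _ _ A]) (use eq1 in auto)
  ultimately show ?thesis using jM jN by (simp add: distrib_right)
qed

text \<open>Conjugation turns the transform of a weight at \<open>- t\<close> into the transform of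
  the conjugate weight at \<open>t\<close>. Equality for all \<open>t\<close> thus passes to the
  conjugates, and from there to the real and imaginary parts of the weights.\<close>

lemma complex_weight_uniqueness:
  fixes w :: "'a \<Rightarrow> complex" and v :: "'b \<Rightarrow> complex"
  assumes M: "prob_space M" and N: "prob_space N"
    and X[measurable]: "X \<in> borel_measurable M" and Y[measurable]: "Y \<in> borel_measurable N"
    and w[measurable]: "w \<in> borel_measurable M" and v[measurable]: "v \<in> borel_measurable N"
    and wb: "\<And>x. cmod (w x) \<le> 1" and vb: "\<And>x. cmod (v x) \<le> 1"
    and eq: "\<And>t. (CLINT x|M. w x * iexp (t * X x)) = (CLINT x|N. v x * iexp (t * Y x))"
    and eq1: "\<And>t. (CLINT x|M. iexp (t * X x)) = (CLINT x|N. iexp (t * Y x))"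
    and A[measurable]: "A \<in> sets borel"
  shows "(CLINT x|M. w x * indicator A (X x)) = (CLINT x|N. v x * indicator A (Y x))"
proof -
  interpret M: prob_space M by fact
  interpret N: prob_space N by fact
  have iM: "integrable M (\<lambda>x. w x * iexp (t * X x))" for t
    using wb by (auto intro!: M.integrable_const_bound[of _ 1] simp: norm_mult)
  have iN: "integrable N (\<lambda>x. v x * iexp (t * Y x))" for t
    using vb by (auto intro!: N.integrable_const_bound[of _ 1] simp: norm_mult)
  have cM: "integrable M (\<lambda>x. cnj (w x * iexp (- t * X x)))" for t
    by (rule integrable_cnj[OF iM])
  have cN: "integrable N (\<lambda>x. cnj (v x * iexp (- t * Y x)))" for t
    by (rule integrable_cnj[OF iN])
  have c: "cnj (iexp (- t * a)) = iexp (t * a)" for t a :: real by (simp add: exp_cnj)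
  have re: "complex_of_real (Re z) * iexp (t * a) = (z * iexp (t * a) + cnj (z * iexp (- t * a))) / 2"
    for z and t a :: real
    unfolding complex_cnj_mult c distrib_right[symmetric] complex_add_cnj by simp
  have im: "complex_of_real (Im z) * iexp (t * a) = (z * iexp (t * a) - cnj (z * iexp (- t * a))) / (2 * \<i>)"
    for z and t a :: real
    unfolding complex_cnj_mult c left_diff_distrib[symmetric] complex_diff_cnj
    by (simp add: complex_eq_iff)
  have ceq: "(CLINT x|M. cnj (w x * iexp (- t * X x))) = (CLINT x|N. cnj (v x * iexp (- t * Y x)))" for t
    using eq[of "- t"] by (simp only: Bochner_Integration.integral_cnj)
  have R: "(LINT x|M. Re (w x) * indicator A (X x)) = (LINT x|N. Re (v x) * indicator A (Y x))"
  proof (rule real_weight_uniqueness[OF M N X Y _ _ _ _ _ eq1 A])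
    show "\<bar>Re (w x)\<bar> \<le> 1" for x using abs_Re_le_cmod[of "w x"] wb[of x] by linarith
    show "\<bar>Re (v x)\<bar> \<le> 1" for x using abs_Re_le_cmod[of "v x"] vb[of x] by linarith
    fix t show "(CLINT x|M. complex_of_real (Re (w x)) * iexp (t * X x)) =
      (CLINT x|N. complex_of_real (Re (v x)) * iexp (t * Y x))"
      unfolding re
      by (simp only: integral_divide_zero Bochner_Integration.integral_add[OF iM cM]
          Bochner_Integration.integral_add[OF iN cN] eq ceq)
  qed auto
  have I: "(LINT x|M. Im (w x) * indicator A (X x)) = (LINT x|N. Im (v x) * indicator A (Y x))"
  proof (rule real_weight_uniqueness[OF M N X Y _ _ _ _ _ eq1 A])
    show "\<bar>Im (w x)\<bar> \<le> 1" for x using abs_Im_le_cmod[of "w x"] wb[of x] by linarith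
    show "\<bar>Im (v x)\<bar> \<le> 1" for x using abs_Im_le_cmod[of "v x"] vb[of x] by linarith
    fix t show "(CLINT x|M. complex_of_real (Im (w x)) * iexp (t * X x)) =
      (CLINT x|N. complex_of_real (Im (v x)) * iexp (t * Y x))"
      unfolding im
      by (simp only: integral_divide_zero Bochner_Integration.integral_diff[OF iM cM]
          Bochner_Integration.integral_diff[OF iN cN] eq ceq)
  qed auto
  have jM: "integrable M (\<lambda>x. w x * indicator A (X x))"
    using wb by (auto intro!: M.integrable_const_bound[of _ 1] simp: norm_mult indicator_def)
  have jN: "integrable N (\<lambda>x. v x * indicator A (Y x))"
    using vb by (auto intro!: N.integrable_const_bound[of _ 1] simp: norm_mult indicator_def)
  have ind: "Re (z * indicator A a) = Re z * indicator A a" "Im (z * indicator A a) = Im z * indicator A a"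
    for z and a :: real by (auto simp: indicator_def)
  show ?thesis
  proof (rule complex_eqI)
    show "Re (CLINT x|M. w x * indicator A (X x)) = Re (CLINT x|N. v x * indicator A (Y x))"
      using R unfolding integral_Re[OF jM, symmetric] integral_Re[OF jN, symmetric] ind .
    show "Im (CLINT x|M. w x * indicator A (X x)) = Im (CLINT x|N. v x * indicator A (Y x))"
      using I unfolding integral_Im[OF jM, symmetric] integral_Im[OF jN, symmetric] ind .
  qed
qed

text \<open>
  Cramer--Wold: the coordinates are moved one at a time from the exponent into the indicator,
  each time by the one-dimensional uniqueness theorem with the remaining factors as a weight.
\<close>

lemma mixed_transform_eq:
  fixes X :: "'k \<Rightarrow> 'a \<Rightarrow> real" and Y :: "'k \<Rightarrow> 'b \<Rightarrow> real"
  assumes M: "prob_space M" and N: "prob_space N" and K: "finite K"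
    and X: "\<And>k. k \<in> K \<Longrightarrow> X k \<in> borel_measurable M"
    and Y: "\<And>k. k \<in> K \<Longrightarrow> Y k \<in> borel_measurable N"
    and eq: "\<And>c. (CLINT x|M. iexp (\<Sum>k\<in>K. c k * X k x)) = (CLINT x|N. iexp (\<Sum>k\<in>K. c k * Y k x))"
    and J: "J \<subseteq> K" and B: "\<And>k. k \<in> J \<Longrightarrow> B k \<in> sets borel"
  shows "(CLINT x|M. (\<Prod>k\<in>J. indicator (B k) (X k x)) * iexp (\<Sum>k\<in>K - J. c k * X k x)) =
    (CLINT x|N. (\<Prod>k\<in>J. indicator (B k) (Y k x)) * iexp (\<Sum>k\<in>K - J. c k * Y k x))"
proof -
  have "finite J" using K J finite_subset by blast
  then show ?thesis using J B
  proof (induction J arbitrary: c rule: finite_induct)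
    case empty
    then show ?case using eq by simp
  next
    case (insert k J)
    have k: "k \<in> K" and JK: "J \<subseteq> K" using insert by auto
    have fin: "finite (K - J)" using K by simp
    define w where "w x = (\<Prod>l\<in>J. indicator (B l) (X l x)) * iexp (\<Sum>l\<in>K - insert k J. c l * X l x)" for x
    define v where "v x = (\<Prod>l\<in>J. indicator (B l) (Y l x)) * iexp (\<Sum>l\<in>K - insert k J. c l * Y l x)" for x
    \<comment> \<open>Changing the coefficient of \<open>k\<close> to \<open>t\<close> isolates
      \<open>t * Z k\<close> as the exponent of a one-dimensional transform; all other factors form
      the weights \<open>w\<close> and \<open>v\<close>.\<close>
    have split: "(\<Sum>l\<in>K - J. (c(k := t)) l * Z l) = (\<Sum>l\<in>K - insert k J. c l * Z l) + t * Z k"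
      for Z :: "'k \<Rightarrow> real" and t
    proof -
      have "k \<in> K - J" using k insert.hyps by simp
      then have "(\<Sum>l\<in>K - J. (c(k := t)) l * Z l) =
          (c(k := t)) k * Z k + (\<Sum>l\<in>K - J - {k}. (c(k := t)) l * Z l)"
        by (rule sum.remove[OF fin])
      also have "(\<Sum>l\<in>K - J - {k}. (c(k := t)) l * Z l) = (\<Sum>l\<in>K - insert k J. c l * Z l)"
        by (intro sum.cong) auto
      finally show ?thesis by simp
    qed
    have "(CLINT x|M. w x * indicator (B k) (X k x)) = (CLINT x|N. v x * indicator (B k) (Y k x))"
    proof (rule complex_weight_uniqueness[OF M N X[OF k] Y[OF k]])
      show "w \<in> borel_measurable M" unfolding w_def
      proof (intro borel_measurable_times borel_measurable_prod)
        fix l assume "l \<in> J"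
        then have [measurable]: "X l \<in> borel_measurable M" "B l \<in> sets borel" using X JK insert.prems by auto
        show "(\<lambda>x. indicator (B l) (X l x) :: complex) \<in> borel_measurable M" by measurable
      next
        have [measurable]: "(\<lambda>x. \<Sum>l\<in>K - insert k J. c l * X l x) \<in> borel_measurable M"
          using X by (intro borel_measurable_sum) auto
        show "(\<lambda>x. iexp (\<Sum>l\<in>K - insert k J. c l * X l x)) \<in> borel_measurable M" by measurable
      qed
      show "v \<in> borel_measurable N" unfolding v_def
      proof (intro borel_measurable_times borel_measurable_prod)
        fix l assume "l \<in> J"
        then have [measurable]: "Y l \<in> borel_measurable N" "B l \<in> sets borel" using Y JK insert.prems by auto
        show "(\<lambda>x. indicator (B l) (Y l x) :: complex) \<in> borel_measurable N" by measurable
      next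
        have [measurable]: "(\<lambda>x. \<Sum>l\<in>K - insert k J. c l * Y l x) \<in> borel_measurable N"
          using Y by (intro borel_measurable_sum) auto
        show "(\<lambda>x. iexp (\<Sum>l\<in>K - insert k J. c l * Y l x)) \<in> borel_measurable N" by measurable
      qed
      show "cmod (w x) \<le> 1" for x unfolding w_def
        by (auto simp: norm_mult prod_norm[symmetric] indicator_def intro!: prod_le_1)
      show "cmod (v x) \<le> 1" for x unfolding v_def
        by (auto simp: norm_mult prod_norm[symmetric] indicator_def intro!: prod_le_1)
      show "(CLINT x|M. w x * iexp (t * X k x)) = (CLINT x|N. v x * iexp (t * Y k x))" for t
        using insert.IH[of "c(k := t)"] insert.prems unfolding split w_def v_def
        by (simp add: exp_add distrib_left mult.assoc)
      show "(CLINT x|M. iexp (t * X k x)) = (CLINT x|N. iexp (t * Y k x))" for t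
      proof -
        have "(\<Sum>l\<in>K. (if l = k then t else 0) * Z l) = t * Z k" for Z :: "'k \<Rightarrow> real"
          using K k by (simp add: if_distrib[of "\<lambda>a. a * _"] cong: if_cong)
        then show ?thesis using eq[of "\<lambda>l. if l = k then t else 0"] by simp
      qed
      show "B k \<in> sets borel" using insert.prems by simp
    qed
    then show ?case
      using insert.hyps unfolding w_def v_def by (simp add: mult_ac)
  qed
qed

text \<open>The probability of a box is put in complex form because the mixed transform is complex
  even when no exponential factor is left.\<close>

lemma emeasure_distr_box:
  fixes Z :: "'k \<Rightarrow> 'c \<Rightarrow> real"
  assumes L: "prob_space L" and K: "finite K" and Z[measurable]: "\<And>k. k \<in> K \<Longrightarrow> Z k \<in> borel_measurable L"
    and A: "\<And>k. k \<in> K \<Longrightarrow> A k \<in> sets borel"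
  shows "emeasure (distr L (\<Pi>\<^sub>M k\<in>K. borel) (\<lambda>x. \<lambda>k\<in>K. Z k x)) (Pi\<^sub>E K A) =
    ennreal (Re (CLINT x|L. (\<Prod>k\<in>K. indicator (A k) (Z k x))))"
proof -
  interpret L: prob_space L by fact
  let ?S = "(\<lambda>x. \<lambda>k\<in>K. Z k x) -` Pi\<^sub>E K A \<inter> space L"
  have Zm[measurable]: "(\<lambda>x. \<lambda>k\<in>K. Z k x) \<in> measurable L (\<Pi>\<^sub>M k\<in>K. borel)"
    by (rule measurable_restrict) (rule Z)
  have PA: "Pi\<^sub>E K A \<in> sets (\<Pi>\<^sub>M k\<in>K. borel)" using A K by (intro sets_PiM_I_finite) auto
  have S: "?S \<in> sets L" by (rule measurable_sets[OF Zm PA])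
  have "(CLINT x|L. (\<Prod>k\<in>K. indicator (A k) (Z k x))) = (CLINT x|L. indicator ?S x)"
  proof (rule Bochner_Integration.integral_cong[OF refl])
    fix x assume x: "x \<in> space L"
    show "(\<Prod>k\<in>K. indicator (A k) (Z k x)) = (indicator ?S x :: complex)"
    proof (cases "\<forall>k\<in>K. Z k x \<in> A k")
      case True
      then show ?thesis using x by (auto simp: indicator_def)
    next
      case False
      then obtain k where k: "k \<in> K" "Z k x \<notin> A k" by auto
      have "(\<Prod>k\<in>K. indicator (A k) (Z k x)) = (0 :: complex)"
        by (rule prod_zero[OF K]) (use k in \<open>auto intro!: bexI[of _ k]\<close>)
      moreover have "x \<notin> ?S" using k by (auto simp: PiE_def Pi_def)
      ultimately show ?thesis by simp
    qed
  qed
  also have "\<dots> = (CLINT x|L. complex_of_real (indicator ?S x))"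
    by (intro Bochner_Integration.integral_cong refl) (simp add: indicator_def)
  also have "\<dots> = complex_of_real (LINT x|L. indicator ?S x)"
    by (rule integral_complex_of_real)
  also have "(LINT x|L. indicator ?S x) = L.prob ?S"
    using S by (simp add: Int_assoc)
  finally show ?thesis
    using emeasure_distr[OF Zm PA] by (simp add: L.emeasure_eq_measure)
qed

text \<open>Once all coordinates sit in indicators, the mixed transform is the probability of a box,
  and boxes form an intersection-stable generator of the product \<sigma>-algebra.\<close>

lemma Cramer_Wold:
  fixes X :: "'k \<Rightarrow> 'a \<Rightarrow> real" and Y :: "'k \<Rightarrow> 'b \<Rightarrow> real"
  assumes M: "prob_space M" and N: "prob_space N" and K: "finite K"
    and X[measurable]: "\<And>k. k \<in> K \<Longrightarrow> X k \<in> borel_measurable M"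
    and Y[measurable]: "\<And>k. k \<in> K \<Longrightarrow> Y k \<in> borel_measurable N"
    and eq: "\<And>c. (CLINT x|M. iexp (\<Sum>k\<in>K. c k * X k x)) = (CLINT x|N. iexp (\<Sum>k\<in>K. c k * Y k x))"
  shows "distr M (\<Pi>\<^sub>M k\<in>K. borel) (\<lambda>x. \<lambda>k\<in>K. X k x) = distr N (\<Pi>\<^sub>M k\<in>K. borel) (\<lambda>x. \<lambda>k\<in>K. Y k x)"
proof (rule measure_eqI_PiM_finite[OF K, of _ "\<lambda>_. borel", where A = "\<lambda>_. space (\<Pi>\<^sub>M k\<in>K. borel)"])
  have Xm[measurable]: "(\<lambda>x. \<lambda>k\<in>K. X k x) \<in> measurable M (\<Pi>\<^sub>M k\<in>K. borel)"
    by (rule measurable_restrict) (rule X)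
  have Ym[measurable]: "(\<lambda>x. \<lambda>k\<in>K. Y k x) \<in> measurable N (\<Pi>\<^sub>M k\<in>K. borel)"
    by (rule measurable_restrict) (rule Y)
  fix A assume A: "\<And>k. k \<in> K \<Longrightarrow> A k \<in> sets (borel :: real measure)"
  show "emeasure (distr M (\<Pi>\<^sub>M k\<in>K. borel) (\<lambda>x. \<lambda>k\<in>K. X k x)) (Pi\<^sub>E K A) =
    emeasure (distr N (\<Pi>\<^sub>M k\<in>K. borel) (\<lambda>x. \<lambda>k\<in>K. Y k x)) (Pi\<^sub>E K A)"
  proof -
    have "emeasure (distr M (\<Pi>\<^sub>M k\<in>K. borel) (\<lambda>x. \<lambda>k\<in>K. X k x)) (Pi\<^sub>E K A) =
      ennreal (Re (CLINT x|M. (\<Prod>k\<in>K. indicator (A k) (X k x))))"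
      by (rule emeasure_distr_box[OF M K X A])
    also have "(CLINT x|M. (\<Prod>k\<in>K. indicator (A k) (X k x))) = (CLINT x|N. (\<Prod>k\<in>K. indicator (A k) (Y k x)))"
      using mixed_transform_eq[of M N K X Y K A, OF M N K X Y eq subset_refl A] by simp
    also have "ennreal (Re \<dots>) = emeasure (distr N (\<Pi>\<^sub>M k\<in>K. borel) (\<lambda>x. \<lambda>k\<in>K. Y k x)) (Pi\<^sub>E K A)"
      by (rule emeasure_distr_box[OF N K Y A, symmetric])
    finally show ?thesis .
  qed
next
  show "range (\<lambda>_::nat. space (\<Pi>\<^sub>M k\<in>K. borel)) \<subseteq> prod_algebra K (\<lambda>_. borel :: real measure)"
    using K by (auto simp: space_PiM intro!: prod_algebraI_finite)
  show "emeasure (distr M (\<Pi>\<^sub>M k\<in>K. borel) (\<lambda>x. \<lambda>k\<in>K. X k x)) (space (\<Pi>\<^sub>M k\<in>K. borel)) \<noteq> \<infinity>"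
  proof -
    interpret M: prob_space M by fact
    have "(\<lambda>x. \<lambda>k\<in>K. X k x) \<in> measurable M (\<Pi>\<^sub>M k\<in>K. borel)"
      by (rule measurable_restrict) (rule X)
    from M.prob_space_distr[OF this] interpret D: prob_space "distr M (\<Pi>\<^sub>M k\<in>K. borel) (\<lambda>x. \<lambda>k\<in>K. X k x)" .
    show ?thesis by simp
  qed
qed auto

text \<open>Characteristic functions converge by dominated convergence with the bound 1, and limits
  are unique.\<close>

lemma distr_eq_limit:
  fixes f g :: "nat \<Rightarrow> 'a \<Rightarrow> real"
  assumes M: "prob_space M" and f: "\<And>n. f n \<in> borel_measurable M" and g: "\<And>n. g n \<in> borel_measurable M"
    and flim: "\<And>x. x \<in> space M \<Longrightarrow> (\<lambda>n. f n x) \<longlonglongrightarrow> F x"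
    and glim: "\<And>x. x \<in> space M \<Longrightarrow> (\<lambda>n. g n x) \<longlonglongrightarrow> G x"
    and eq: "\<And>n. distr M borel (f n) = distr M borel (g n)"
  shows "distr M borel F = distr M borel G"
proof -
  interpret prob_space M by fact
  have Fm: "F \<in> borel_measurable M" by (rule borel_measurable_LIMSEQ_real[OF flim f])
  have Gm: "G \<in> borel_measurable M" by (rule borel_measurable_LIMSEQ_real[OF glim g])
  have lim: "(\<lambda>n. CLINT x|M. iexp (t * h n x)) \<longlonglongrightarrow> (CLINT x|M. iexp (t * H x))"
    if [measurable]: "\<And>n. h n \<in> borel_measurable M" "H \<in> borel_measurable M"
      and hlim: "\<And>x. x \<in> space M \<Longrightarrow> (\<lambda>n. h n x) \<longlonglongrightarrow> H x" for h :: "nat \<Rightarrow> 'a \<Rightarrow> real" and H t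
  proof (rule integral_dominated_convergence[where w = "\<lambda>_. 1"])
    show "AE x in M. (\<lambda>n. iexp (t * h n x)) \<longlonglongrightarrow> iexp (t * H x)"
      by (rule AE_I2) (intro tendsto_intros hlim)
  qed auto
  show ?thesis
  proof (rule distr_eqI_char[OF M M Fm Gm])
    fix t
    have "(CLINT x|M. iexp (t * f n x)) = (CLINT x|M. iexp (t * g n x))" for n
      unfolding char_distr[OF f, symmetric] char_distr[OF g, symmetric] eq ..
    then show "(CLINT x|M. iexp (t * F x)) = (CLINT x|M. iexp (t * G x))"
      using lim[OF f Fm flim, of t] lim[OF g Gm glim, of t] LIMSEQ_unique by simp
  qed
qed

section \<open>The asymptotic covariance matrix\<close>

lemma index_mult_sum:
  assumes "A \<in> carrier_mat n k" "B \<in> carrier_mat k p" "i < n" "j < p"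
  shows "(A * B) $$ (i, j) = (\<Sum>l<k. A $$ (i, l) * B $$ (l, j))"
  using assms by (auto simp: scalar_prod_def lessThan_atLeast0 intro!: sum.cong)

lemma stochastic_matD:
  assumes "stochastic_mat m P"
  shows "P \<in> carrier_mat m m" "\<And>i j. i < m \<Longrightarrow> j < m \<Longrightarrow> 0 \<le> P $$ (i, j)"
    "\<And>i. i < m \<Longrightarrow> (\<Sum>j<m. P $$ (i, j)) = 1"
  using assms by (auto simp: stochastic_mat_def)

section \<open>Harmonic vectors of an irreducible chain\<close>

lemma harmonic_pow:
  assumes P: "stochastic_mat m P" and v: "\<And>i. i < m \<Longrightarrow> (\<Sum>j<m. P $$ (i, j) * v j) = v i"
  shows "i < m \<Longrightarrow> (\<Sum>j<m. (P ^\<^sub>m n) $$ (i, j) * v j) = v i"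
proof (induction n)
  case 0
  have "(\<Sum>j<m. (P ^\<^sub>m 0) $$ (i, j) * v j) = (\<Sum>j<m. if i = j then v j else 0)"
    using 0 stochastic_matD(1)[OF P] by (intro sum.cong) auto
  then show ?case using 0 by simp
next
  case (Suc n)
  note Pc = stochastic_matD(1)[OF P]
  have "(\<Sum>j<m. (P ^\<^sub>m Suc n) $$ (i, j) * v j) =
      (\<Sum>j<m. \<Sum>l<m. (P ^\<^sub>m n) $$ (i, l) * (P $$ (l, j) * v j))"
    using Suc.prems Pc
    by (intro sum.cong refl)
      (simp add: index_mult_sum[OF pow_carrier_mat[OF Pc] Pc] sum_distrib_right mult.assoc del: index_mult_mat)
  also have "\<dots> = (\<Sum>l<m. (P ^\<^sub>m n) $$ (i, l) * (\<Sum>j<m. P $$ (l, j) * v j))"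
    by (subst sum.swap) (simp add: sum_distrib_left)
  also have "\<dots> = v i" using Suc by (simp add: v)
  finally show ?case .
qed

lemma pow_nonneg:
  assumes P: "stochastic_mat m P"
  shows "i < m \<Longrightarrow> j < m \<Longrightarrow> 0 \<le> (P ^\<^sub>m n) $$ (i, j)"
proof (induction n arbitrary: j)
  case 0
  then show ?case using stochastic_matD(1)[OF P] by simp
next
  case (Suc n)
  note Pc = stochastic_matD(1)[OF P]
  show ?case
    using Suc stochastic_matD(2)[OF P]
    by (simp add: index_mult_sum[OF pow_carrier_mat[OF Pc] Pc] del: index_mult_mat)
      (intro sum_nonneg mult_nonneg_nonneg, auto)
qed

text \<open>Maximum principle: a minimum of \<open>v\<close> propagates along every path of positive probability.\<close>

lemma harmonic_constant:
  fixes v :: "nat \<Rightarrow> real"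
  assumes P: "stochastic_mat m P" and irr: "irreducible_chain m P"
    and v: "\<And>i. i < m \<Longrightarrow> (\<Sum>j<m. P $$ (i, j) * v j) = v i"
    and ij: "i < m" "j < m"
  shows "v i = v j"
proof -
  obtain a where a: "a < m" "\<And>j. j < m \<Longrightarrow> v a \<le> v j"
    using ij arg_min_if_finite[of "{..<m}" v]
    by (metis finite_lessThan lessThan_iff lessThan_empty_iff less_nat_zero_code not_le)
  have "v j = v a" if j: "j < m" for j
  proof -
    obtain n where n: "(P ^\<^sub>m n) $$ (a, j) > 0"
      using irr a(1) j by (auto simp: irreducible_chain_def)
    \<comment> \<open>The constant vector is harmonic too, so the power has row sum 1. Subtracting
      \<open>v a\<close> times this identity from that for \<open>v\<close> leaves a vanishing sum
      of nonnegative terms.\<close>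
    have "(\<Sum>l<m. (P ^\<^sub>m n) $$ (a, l) * 1) = 1"
      by (rule harmonic_pow[OF P]) (use a stochastic_matD(3)[OF P] in auto)
    then have "(\<Sum>l<m. (P ^\<^sub>m n) $$ (a, l) * (v l - v a)) = 0"
      using harmonic_pow[OF P v a(1), of n]
      by (simp add: right_diff_distrib sum_subtractf flip: sum_distrib_right)
    then have "\<forall>l\<in>{..<m}. (P ^\<^sub>m n) $$ (a, l) * (v l - v a) = 0"
      by (subst (asm) sum_nonneg_eq_0_iff) (use pow_nonneg[OF P a(1)] a(2) in auto)
    from bspec[OF this, of j] show ?thesis using n j by simp
  qed
  then show ?thesis using ij by simp
qed

lemma complex_harmonic_constant:
  fixes v :: "nat \<Rightarrow> complex"
  assumes P: "stochastic_mat m P" and irr: "irreducible_chain m P"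
    and v: "\<And>i. i < m \<Longrightarrow> (\<Sum>j<m. complex_of_real (P $$ (i, j)) * v j) = v i"
    and ij: "i < m" "j < m"
  shows "v i = v j"
proof (rule complex_eqI)
  show "Re (v i) = Re (v j)"
    by (rule harmonic_constant[OF P irr _ ij]) (use arg_cong[OF v, of _ Re] in simp)
  show "Im (v i) = Im (v j)"
    by (rule harmonic_constant[OF P irr _ ij]) (use arg_cong[OF v, of _ Im] in simp)
qed

text \<open>A vector fixed by \<open>P\<close> is constant, hence equal to its \<pi>-mean, which is
  coordinate 0 of its image under \<open>S\<close>. Column 0 of \<open>S_inv\<close> is fixed and
  has that coordinate 1, so it is the constant vector 1. A fixed vector of \<open>L\<close>, padded
  by a 0 and mapped by \<open>S_inv\<close>, is fixed and has that coordinate 0, so it vanishes;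
  hence 1 is no eigenvalue of \<open>L\<close>.\<close>

lemma eigenvalue_one_simple:
  assumes P: "stochastic_mat m P" and irr: "irreducible_chain m P" and m: "m \<ge> 1"
    and stat: "stationary_distribution m P \<pi>"
    and J: "jordan_decomposition m P \<pi> S S_inv L"
  shows "det (1\<^sub>m (m - 1) - L) \<noteq> 0"
    and "\<And>i. i < m \<Longrightarrow> S_inv $$ (i, 0) = 1"
proof -
  let ?k = "m - 1"
  define A where "A = diag_block_mat [1\<^sub>m 1, L]"
  let ?Pc = "map_mat complex_of_real P"
  have Lc: "L \<in> carrier_mat ?k ?k" and sim: "similar_mat_wit ?Pc A S_inv S"
    and S0: "\<And>j. j < m \<Longrightarrow> S $$ (0, j) = complex_of_real (\<pi> j)"
    using J by (auto simp: jordan_decomposition_def A_def)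
  note Pcar = stochastic_matD(1)[OF P]
  have Pc: "?Pc \<in> carrier_mat m m" using Pcar by simp
  note w = similar_mat_witD2[OF Pc sim]
  have A: "A = four_block_mat (1\<^sub>m 1) (0\<^sub>m 1 ?k) (0\<^sub>m ?k 1) L"
    unfolding A_def diag_block_mat.simps(2)[of "1\<^sub>m 1" "[L]"] diag_block_mat_singleton Let_def
    using Lc by simp
  have PS: "?Pc * S_inv = S_inv * A"
  proof -
    have "?Pc * S_inv = (S_inv * A) * (S * S_inv)"
      unfolding w(3) by (rule assoc_mult_mat[of _ m m _ m _ m]) (use w in auto)
    then show ?thesis using w(2) right_mult_one_mat[OF mult_carrier_mat[OF w(6) w(5)]] by simp
  qed
  have pisum: "(\<Sum>j<m. complex_of_real (\<pi> j)) = 1"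
  proof -
    have "(\<Sum>j<m. \<pi> j) = 1" using stat by (simp add: stationary_distribution_def)
    from arg_cong[OF this, of complex_of_real] show ?thesis by simp
  qed
  have fixed: "v i = (\<Sum>j<m. S $$ (0, j) * v j)"
    if v: "\<And>i. i < m \<Longrightarrow> (\<Sum>j<m. complex_of_real (P $$ (i, j)) * v j) = v i" and i: "i < m" for v i
  proof -
    have "(\<Sum>j<m. S $$ (0, j) * v j) = (\<Sum>j<m. complex_of_real (\<pi> j) * v i)"
    proof (intro sum.cong refl)
      fix j assume j: "j \<in> {..<m}"
      then have "v j = v i" using complex_harmonic_constant[OF P irr v _ i] by simp
      then show "S $$ (0, j) * v j = complex_of_real (\<pi> j) * v i" using S0 j by simp
    qed
    then show ?thesis using pisum by (simp flip: sum_distrib_right)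
  qed
  show "S_inv $$ (i, 0) = 1" if i: "i < m" for i
  proof -
    have "(\<Sum>j<m. complex_of_real (P $$ (i, j)) * S_inv $$ (j, 0)) = S_inv $$ (i, 0)" if i: "i < m" for i
    proof -
      have "(\<Sum>j<m. complex_of_real (P $$ (i, j)) * S_inv $$ (j, 0)) = (?Pc * S_inv) $$ (i, 0)"
        using i m Pcar by (subst index_mult_sum[OF Pc w(6)]) auto
      also have "\<dots> = (\<Sum>j<m. S_inv $$ (i, j) * A $$ (j, 0))"
        unfolding PS by (subst index_mult_sum[OF w(6) w(5)]) (use i m in auto)
      also have "\<dots> = (\<Sum>j<m. if j = 0 then S_inv $$ (i, j) else 0)"
        unfolding A using Lc by (intro sum.cong) auto
      finally show ?thesis using m by simp
    qed
    from fixed[OF this i] have "S_inv $$ (i, 0) = (\<Sum>j<m. S $$ (0, j) * S_inv $$ (j, 0))" by simp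
    also have "\<dots> = (S * S_inv) $$ (0, 0)"
      using m by (subst index_mult_sum[OF w(7) w(6)]) auto
    also have "\<dots> = 1" using w(2) m by simp
    finally show ?thesis .
  qed
  show "det (1\<^sub>m ?k - L) \<noteq> 0"
  proof
    assume "det (1\<^sub>m ?k - L) = 0"
    moreover have "1\<^sub>m ?k - L \<in> carrier_mat ?k ?k" by (rule minus_carrier_mat[OF Lc])
    ultimately obtain x where x: "x \<in> carrier_vec ?k" "x \<noteq> 0\<^sub>v ?k" "(1\<^sub>m ?k - L) *\<^sub>v x = 0\<^sub>v ?k"
      using det_0_iff_vec_prod_zero by blast
    have Lx: "L *\<^sub>v x = x"
    proof -
      have "x - L *\<^sub>v x = 0\<^sub>v ?k"
        using x(1,3) Lc by (simp add: minus_mult_distrib_mat_vec[of _ ?k ?k])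
      then show ?thesis using x(1) Lc
        by (intro eq_vecI) (auto simp: vec_eq_iff)
    qed
    define y where "y = 0\<^sub>v 1 @\<^sub>v x"
    have y: "y \<in> carrier_vec m" unfolding y_def using x(1) m
      by (metis append_carrier_vec le_add_diff_inverse zero_carrier_vec)
    have z: "0\<^sub>m 1 ?k *\<^sub>v x = 0\<^sub>v 1" "0\<^sub>m ?k 1 *\<^sub>v 0\<^sub>v 1 = (0\<^sub>v ?k :: complex vec)"
      using x(1) by (auto intro!: eq_vecI simp: scalar_prod_def)
    have Ay: "A *\<^sub>v y = y"
      unfolding A y_def using four_block_mat_mult_vec[of "1\<^sub>m 1" 1 1 "0\<^sub>m 1 ?k" ?k "0\<^sub>m ?k 1" ?k L "0\<^sub>v 1" x]
        Lc x(1) Lx z by simp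
    define v where "v = S_inv *\<^sub>v y"
    have v: "v \<in> carrier_vec m" unfolding v_def using w(6) y by (rule mult_mat_vec_carrier)
    have Pv: "?Pc *\<^sub>v v = v"
    proof -
      have "?Pc *\<^sub>v v = (?Pc * S_inv) *\<^sub>v y"
        unfolding v_def by (rule assoc_mult_mat_vec[of _ m m _ m, symmetric]) (use w y in auto)
      also have "\<dots> = S_inv *\<^sub>v (A *\<^sub>v y)"
        unfolding PS by (rule assoc_mult_mat_vec[of _ m m _ m]) (use w y in auto)
      finally show ?thesis unfolding Ay v_def .
    qed
    have Sv: "S *\<^sub>v v = y"
    proof -
      have "S *\<^sub>v v = (S * S_inv) *\<^sub>v y"
        unfolding v_def by (rule assoc_mult_mat_vec[of _ m m _ m, symmetric]) (use w y in auto)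
      then show ?thesis using w y by simp
    qed
    have "v $ i = 0" if i: "i < m" for i
    proof -
      have "v $ i = (\<Sum>j<m. S $$ (0, j) * v $ j)"
      proof (rule fixed[OF _ i])
        fix i assume i: "i < m"
        have "(?Pc *\<^sub>v v) $ i = (\<Sum>j<m. complex_of_real (P $$ (i, j)) * v $ j)"
          using i Pcar v by (auto simp: scalar_prod_def lessThan_atLeast0 intro!: sum.cong)
        then show "(\<Sum>j<m. complex_of_real (P $$ (i, j)) * v $ j) = v $ i" using Pv by simp
      qed
      also have "\<dots> = (S *\<^sub>v v) $ 0"
        using m v w(7) by (auto simp: scalar_prod_def lessThan_atLeast0 intro!: sum.cong)
      also have "\<dots> = 0" unfolding Sv y_def using m by simp
      finally show ?thesis .
    qed
    then have "v = 0\<^sub>v m" using v by (intro eq_vecI) auto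
    moreover have "S *\<^sub>v 0\<^sub>v m = 0\<^sub>v m"
      using w(7) by (intro eq_vecI) (auto simp: scalar_prod_def)
    ultimately have "y = 0\<^sub>v m" using Sv by simp
    have "x = 0\<^sub>v ?k"
    proof (rule eq_vecI)
      fix i assume i: "i < dim_vec (0\<^sub>v ?k :: complex vec)"
      then have "y $ Suc i = x $ i" using x(1) by (simp add: y_def)
      then show "x $ i = 0\<^sub>v ?k $ i" unfolding \<open>y = 0\<^sub>v m\<close> using i by simp
    qed (use x(1) in simp)
    then show False using x(2) by simp
  qed
qed

text \<open>\<open>W\<close> is the potential (deviation) matrix of the chain, \<open>S_inv\<close>
  times diag(0, (I - L)^-1) times \<open>S\<close>. It solves (I - P) W = I - 1 \<pi> and \<pi> W =
  0, with 1 the constant column. These equations, together with \<Sigma> written in terms of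
  \<open>W\<close>, are all that later arguments use, so the Jordan decomposition disappears
  here.\<close>

lemma covariance_via_potential:
  assumes m: "m \<ge> 1" and P: "stochastic_mat m P" and irr: "irreducible_chain m P"
    and stat: "stationary_distribution m P \<pi>" and cov: "asymptotic_covariance m P \<pi> \<Sigma>"
  obtains W :: "complex mat" where "W \<in> carrier_mat m m"
    "\<And>i j. i < m \<Longrightarrow> j < m \<Longrightarrow> W $$ (i, j) - (\<Sum>l<m. complex_of_real (P $$ (i, l)) * W $$ (l, j)) =
       (if i = j then 1 else 0) - complex_of_real (\<pi> j)"
    "\<And>j. j < m \<Longrightarrow> (\<Sum>i<m. complex_of_real (\<pi> i) * W $$ (i, j)) = 0"
    "\<And>i j. i < m \<Longrightarrow> j < m \<Longrightarrow> complex_of_real (\<Sigma> $$ (i, j)) =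
       (if i = j then - complex_of_real (\<pi> i) else 0) + complex_of_real (\<pi> i * \<pi> j) +
       complex_of_real (\<pi> i) * W $$ (i, j) + complex_of_real (\<pi> j) * W $$ (j, i)"
proof -
  let ?k = "m - 1" and ?Pc = "map_mat complex_of_real P"
  obtain S S_inv L where J: "jordan_decomposition m P \<pi> S S_inv L"
    and cov': "let D = diag_block_mat [mat_diag 1 (\<lambda>_. - 1 / 2), L * the (mat_inverse (1\<^sub>m (m - 1) - L))];
             Z = S_inv * D * S;
             Pi = mat_diag m (\<lambda>i. complex_of_real (\<pi> i))
         in map_mat complex_of_real \<Sigma> = Pi + Pi * Z + transpose_mat Z * Pi"
    and \<Sigma>: "\<Sigma> \<in> carrier_mat m m"
    using cov by (auto simp: asymptotic_covariance_def)
  have two: "diag_block_mat [A, B] = four_block_mat A (0\<^sub>m (dim_row A) (dim_col B)) (0\<^sub>m (dim_row B) (dim_col A)) B"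
    for A B :: "complex mat"
    unfolding diag_block_mat.simps(2)[of A "[B]"] diag_block_mat_singleton Let_def by simp
  define A where "A = diag_block_mat [1\<^sub>m 1, L]"
  have L: "L \<in> carrier_mat ?k ?k" and sim: "similar_mat_wit ?Pc A S_inv S"
    and S0: "\<And>j. j < m \<Longrightarrow> S $$ (0, j) = complex_of_real (\<pi> j)"
    using J by (auto simp: jordan_decomposition_def A_def)
  have Pcar: "P \<in> carrier_mat m m" using stochastic_matD(1)[OF P] .
  then have Pc: "?Pc \<in> carrier_mat m m" by simp
  note w = similar_mat_witD2[OF Pc sim]
  define N where "N = the (mat_inverse (1\<^sub>m ?k - L))"
  have IL: "1\<^sub>m ?k - L \<in> carrier_mat ?k ?k" by (rule minus_carrier_mat[OF L])
  have unit: "1\<^sub>m ?k - L \<in> Units (ring_mat TYPE(complex) ?k ())"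
    by (rule det_non_zero_imp_unit[OF IL eigenvalue_one_simple(1)[OF P irr m stat J]])
  have "mat_inverse (1\<^sub>m ?k - L) \<noteq> None"
  proof
    assume "mat_inverse (1\<^sub>m ?k - L) = None"
    from mat_inverse(1)[OF IL this, where b = "()"] show False using unit by contradiction
  qed
  then obtain N' where N': "mat_inverse (1\<^sub>m ?k - L) = Some N'" by blast
  then have N: "(1\<^sub>m ?k - L) * N = 1\<^sub>m ?k" "N \<in> carrier_mat ?k ?k"
    using mat_inverse(2)[OF IL] by (auto simp: N_def)
  have LN: "L * N = N - 1\<^sub>m ?k"
  proof -
    have NLN: "N - L * N = 1\<^sub>m ?k"
      using N L minus_mult_distrib_mat[of "1\<^sub>m ?k" ?k ?k L N ?k] by simp
    show ?thesis
    proof (rule eq_matI)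
      fix i j assume ij: "i < dim_row (N - 1\<^sub>m ?k)" "j < dim_col (N - 1\<^sub>m ?k)"
      then have "(N - L * N) $$ (i, j) = 1\<^sub>m ?k $$ (i, j)" unfolding NLN by simp
      then show "(L * N) $$ (i, j) = (N - 1\<^sub>m ?k) $$ (i, j)"
        using ij N(2) L by (simp del: index_mult_mat(1) add: algebra_simps)
    qed (use N L in auto)
  qed
  define E where "E = four_block_mat (1\<^sub>m 1) (0\<^sub>m 1 ?k) (0\<^sub>m ?k 1) (0\<^sub>m ?k ?k :: complex mat)"
  define U where "U = four_block_mat (0\<^sub>m 1 1) (0\<^sub>m 1 ?k) (0\<^sub>m ?k 1) N"
  define D where "D = diag_block_mat [mat_diag 1 (\<lambda>_. - 1 / 2), L * N]"
  have mk: "1 + ?k = m" using m by simp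
  have A4: "A = four_block_mat (1\<^sub>m 1) (0\<^sub>m 1 ?k) (0\<^sub>m ?k 1) L"
    unfolding A_def two using L by simp
  have car: "E \<in> carrier_mat m m" "U \<in> carrier_mat m m" "D \<in> carrier_mat m m"
    using N(2) L mk unfolding E_def U_def D_def two by (auto simp: mat_diag_def)
  have D: "D = U - 1\<^sub>m m + (1 / 2) \<cdot>\<^sub>m E"
  proof (rule eq_matI)
    fix i j assume ij: "i < dim_row (U - 1\<^sub>m m + (1 / 2) \<cdot>\<^sub>m E)" "j < dim_col (U - 1\<^sub>m m + (1 / 2) \<cdot>\<^sub>m E)"
    show "D $$ (i, j) = (U - 1\<^sub>m m + (1 / 2) \<cdot>\<^sub>m E) $$ (i, j)"
      using ij car N(2) L mk unfolding D_def two LN U_def E_def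
      by (auto simp: mat_diag_def)
  qed (use car in auto)
  have AU: "U - A * U = 1\<^sub>m m - E"
  proof -
    have "A * U = four_block_mat (0\<^sub>m 1 1) (0\<^sub>m 1 ?k) (0\<^sub>m ?k 1) (L * N)"
      unfolding A4 U_def
      by (subst mult_four_block_mat[of _ 1 1 _ ?k _ ?k _ _ 1 _ ?k]) (use L N in auto)
    then show ?thesis
      unfolding LN U_def E_def using N(2) mk by (intro eq_matI) auto
  qed
  define W where "W = S_inv * U * S"
  have W: "W \<in> carrier_mat m m" unfolding W_def using w car by simp
  have conj_entry: "(S_inv * X * S) $$ (i, j) = (\<Sum>a<m. \<Sum>b<m. S_inv $$ (i, a) * X $$ (a, b) * S $$ (b, j))"
    if X: "X \<in> carrier_mat m m" and ij: "i < m" "j < m" for X :: "complex mat" and i j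
  proof -
    have "(S_inv * X * S) $$ (i, j) = (\<Sum>b<m. \<Sum>a<m. S_inv $$ (i, a) * X $$ (a, b) * S $$ (b, j))"
      using index_mult_sum[OF mult_carrier_mat[OF w(6) X] w(7) ij] ij
      by (simp add: index_mult_sum[OF w(6) X] sum_distrib_right del: index_mult_mat)
    then show ?thesis by (subst sum.swap) simp
  qed
  \<comment> \<open>Only column 0 of \<open>S_inv\<close>, which is constantly 1, and row 0 of
    \<open>S\<close>, which is \<pi>, survive: this is the spectral projection for the eigenvalue
    1.\<close>
  have SE: "(S_inv * E * S) $$ (i, j) = complex_of_real (\<pi> j)" if ij: "i < m" "j < m" for i j
  proof -
    have "(S_inv * E * S) $$ (i, j) = (\<Sum>a<m. \<Sum>b<m. if a = 0 then if b = 0 then S_inv $$ (i, 0) * S $$ (0, j) else 0 else 0)"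
      unfolding conj_entry[OF car(1) ij] using mk by (intro sum.cong refl) (auto simp: E_def)
    also have "\<dots> = (\<Sum>a<m. if a = 0 then S_inv $$ (i, 0) * S $$ (0, j) else 0)"
      using m by (intro sum.cong refl) auto
    also have "\<dots> = S_inv $$ (i, 0) * S $$ (0, j)" using m by simp
    finally show ?thesis
      using eigenvalue_one_simple(2)[OF P irr m stat J ij(1)] S0 ij by simp
  qed
  have S1: "(S_inv * 1\<^sub>m m * S) $$ (i, j) = (if i = j then 1 else 0)" if ij: "i < m" "j < m" for i j
    using w ij by (simp del: index_mult_mat)
  have PW: "?Pc * W = S_inv * (A * U) * S"
  proof -
    have "?Pc * W = (S_inv * A * S) * (S_inv * (U * S))"
      unfolding W_def w(3)[symmetric] using w car by (simp add: assoc_mult_mat[of _ m m _ m _ m])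
    also have "\<dots> = S_inv * A * (S * (S_inv * (U * S)))"
      by (rule assoc_mult_mat[of _ m m _ m _ m]) (use w car in auto)
    also have "S * (S_inv * (U * S)) = U * S"
      using assoc_mult_mat[of S m m S_inv m "U * S" m] w car by simp
    also have "S_inv * A * (U * S) = S_inv * (A * U) * S"
    proof -
      have "S_inv * A * (U * S) = S_inv * (A * (U * S))"
        by (rule assoc_mult_mat[of _ m m _ m _ m]) (use w car in auto)
      also have "A * (U * S) = A * U * S"
        by (rule assoc_mult_mat[of _ m m _ m _ m, symmetric]) (use w car in auto)
      also have "S_inv * (A * U * S) = S_inv * (A * U) * S"
        by (rule assoc_mult_mat[of _ m m _ m _ m, symmetric]) (use w car in auto)
      finally show ?thesis .
    qed
    finally show ?thesis .
  qed
  have lin: "(S_inv * (X - Y) * S) $$ (i, j) = (S_inv * X * S) $$ (i, j) - (S_inv * Y * S) $$ (i, j)"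
    if "X \<in> carrier_mat m m" "Y \<in> carrier_mat m m" "i < m" "j < m" for X Y :: "complex mat" and i j
  proof -
    have XY: "X - Y \<in> carrier_mat m m" by (rule minus_carrier_mat[OF that(2)])
    show ?thesis
      unfolding conj_entry[OF XY that(3,4)] conj_entry[OF that(1,3,4)] conj_entry[OF that(2,3,4)]
      using that by (simp add: algebra_simps flip: sum_subtractf)
  qed
  show thesis
  proof (rule that[OF W])
    fix i j assume ij: "i < m" "j < m"
    have "W $$ (i, j) - (\<Sum>l<m. complex_of_real (P $$ (i, l)) * W $$ (l, j)) = W $$ (i, j) - (?Pc * W) $$ (i, j)"
      using ij Pcar by (subst index_mult_sum[OF Pc W ij]) simp
    also have "\<dots> = (S_inv * (U - A * U) * S) $$ (i, j)"
      unfolding PW using lin[of U "A * U" i j] car w ij by (simp add: W_def del: index_mult_mat)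
    also have "\<dots> = (if i = j then 1 else 0) - complex_of_real (\<pi> j)"
      unfolding AU using lin[of "1\<^sub>m m" E i j] car SE S1 ij by (simp del: index_mult_mat)
    finally show "W $$ (i, j) - (\<Sum>l<m. complex_of_real (P $$ (i, l)) * W $$ (l, j)) =
       (if i = j then 1 else 0) - complex_of_real (\<pi> j)" .
  next
    fix j assume j: "j < m"
    \<comment> \<open>Row 0 of \<open>S\<close> is \<pi> and row 0 of \<open>U\<close> is 0, so
      reading this identity in row 0 gives \<pi> W = 0.\<close>
    have SW: "S * W = U * S"
      unfolding W_def using w car
      by (simp add: assoc_mult_mat[of S_inv m m U m S m] flip: assoc_mult_mat[of S m m S_inv m "U * S" m])
    have "(\<Sum>i<m. complex_of_real (\<pi> i) * W $$ (i, j)) = (S * W) $$ (0, j)"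
      using j m S0 by (subst index_mult_sum[OF w(7) W]) auto
    also have "\<dots> = (\<Sum>i<m. U $$ (0, i) * S $$ (i, j))"
      unfolding SW using j m by (subst index_mult_sum[OF car(2) w(7)]) auto
    also have "\<dots> = 0"
      using mk N(2) by (intro sum.neutral) (auto simp: U_def)
    finally show "(\<Sum>i<m. complex_of_real (\<pi> i) * W $$ (i, j)) = 0" .
  next
    fix i j assume ij: "i < m" "j < m"
    define Z where "Z = S_inv * D * S"
    define Pi where "Pi = mat_diag m (\<lambda>i. complex_of_real (\<pi> i))"
    have Zc: "Z \<in> carrier_mat m m" unfolding Z_def using w car by simp
    have Pic: "Pi \<in> carrier_mat m m" unfolding Pi_def by simp
    have Z: "Z $$ (i, j) = W $$ (i, j) - (if i = j then 1 else 0) + complex_of_real (\<pi> j) / 2"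
      if ij: "i < m" "j < m" for i j
    proof -
      have UI: "U - 1\<^sub>m m \<in> carrier_mat m m" by (rule minus_carrier_mat) simp
      have "Z $$ (i, j) = (S_inv * (U - 1\<^sub>m m) * S) $$ (i, j) + (S_inv * E * S) $$ (i, j) / 2"
        unfolding Z_def conj_entry[OF car(3) ij] conj_entry[OF UI ij] conj_entry[OF car(1) ij]
        unfolding D
        using car
        by (simp add: distrib_left distrib_right sum.distrib sum_divide_distrib)
      then show ?thesis using lin[of U "1\<^sub>m m" i j] S1 SE car ij by (simp add: W_def del: index_mult_mat)
    qed
    have "map_mat complex_of_real \<Sigma> = Pi + Pi * Z + transpose_mat Z * Pi"
      using cov' unfolding Let_def Z_def Pi_def D_def N_def .
    then have "complex_of_real (\<Sigma> $$ (i, j)) = (Pi + Pi * Z + transpose_mat Z * Pi) $$ (i, j)"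
      using \<Sigma> ij by (metis carrier_matD index_map_mat(1))
    also have "\<dots> = Pi $$ (i, j) + (Pi * Z) $$ (i, j) + (transpose_mat Z * Pi) $$ (i, j)"
      using ij Zc Pic by (simp del: index_mult_mat(1))
    also have "(Pi * Z) $$ (i, j) = complex_of_real (\<pi> i) * Z $$ (i, j)"
      unfolding Pi_def using Zc ij by (subst mat_diag_mult_left[OF Zc]) simp
    also have "(transpose_mat Z * Pi) $$ (i, j) = Z $$ (j, i) * complex_of_real (\<pi> j)"
      unfolding Pi_def using Zc ij by (subst mat_diag_mult_right[of _ m m]) auto
    also have "Pi $$ (i, j) = (if i = j then complex_of_real (\<pi> i) else 0)"
      unfolding Pi_def using ij by (simp add: mat_diag_def)
    finally show "complex_of_real (\<Sigma> $$ (i, j)) =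
       (if i = j then - complex_of_real (\<pi> i) else 0) + complex_of_real (\<pi> i * \<pi> j) +
       complex_of_real (\<pi> i) * W $$ (i, j) + complex_of_real (\<pi> j) * W $$ (j, i)"
      unfolding Z[OF ij] Z[OF ij(2,1)] by (cases "i = j") (simp_all add: algebra_simps)
  qed
qed

text \<open>All relations are linear in \<open>W\<close> with real coefficients and real right-hand
  sides, so the entrywise real part satisfies them as well; \<open>W\<close> itself need not be
  shown real.\<close>

lemma covariance_via_real_potential:
  assumes m: "m \<ge> 1" and P: "stochastic_mat m P" and irr: "irreducible_chain m P"
    and stat: "stationary_distribution m P \<pi>" and cov: "asymptotic_covariance m P \<pi> \<Sigma>"
  shows "\<exists>w. (\<forall>i<m. \<forall>j<m. w i j - (\<Sum>l<m. P $$ (i, l) * w l j) = (if i = j then 1 else 0) - \<pi> j) \<and>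
    (\<forall>j<m. (\<Sum>i<m. \<pi> i * w i j) = 0) \<and>
    (\<forall>i<m. \<forall>j<m. \<Sigma> $$ (i, j) = (if i = j then - \<pi> i else 0) + \<pi> i * \<pi> j + \<pi> i * w i j + \<pi> j * w j i)"
proof (rule covariance_via_potential[OF assms])
  fix W :: "complex mat"
  assume W: "\<And>i j. i < m \<Longrightarrow> j < m \<Longrightarrow>
       W $$ (i, j) - (\<Sum>l<m. complex_of_real (P $$ (i, l)) * W $$ (l, j)) =
       (if i = j then 1 else 0) - complex_of_real (\<pi> j)"
    "\<And>j. j < m \<Longrightarrow> (\<Sum>i<m. complex_of_real (\<pi> i) * W $$ (i, j)) = 0"
    "\<And>i j. i < m \<Longrightarrow> j < m \<Longrightarrow> complex_of_real (\<Sigma> $$ (i, j)) =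
       (if i = j then - complex_of_real (\<pi> i) else 0) + complex_of_real (\<pi> i * \<pi> j) +
       complex_of_real (\<pi> i) * W $$ (i, j) + complex_of_real (\<pi> j) * W $$ (j, i)"
  define w where "w i j = Re (W $$ (i, j))" for i j
  show ?thesis
  proof (intro exI[of _ w] conjI allI impI)
    fix i j assume ij: "i < m" "j < m"
    show "w i j - (\<Sum>l<m. P $$ (i, l) * w l j) = (if i = j then 1 else 0) - \<pi> j"
      using arg_cong[OF W(1)[OF ij], of Re] by (auto simp: w_def)
    show "\<Sigma> $$ (i, j) = (if i = j then - \<pi> i else 0) + \<pi> i * \<pi> j + \<pi> i * w i j + \<pi> j * w j i"
      using arg_cong[OF W(3)[OF ij], of Re] by (auto simp: w_def)
  next
    fix j assume j: "j < m"
    show "(\<Sum>i<m. \<pi> i * w i j) = 0"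
      using arg_cong[OF W(2)[OF j], of Re] by (simp add: w_def)
  qed
qed

text \<open>The vector \<open>g\<close> is the potential of \<open>f\<close>, a solution of
  Poisson's equation. The right-hand side is the variance of the stationary martingale increment
  g(X_1) - (P g)(X_0), as in the martingale proof of the central limit theorem for Markov chains.
  Both nonnegativity and the degenerate direction can be read off it.\<close>

lemma covariance_quadratic_form:
  assumes m: "m \<ge> 1" and P: "stochastic_mat m P" and irr: "irreducible_chain m P"
    and stat: "stationary_distribution m P \<pi>" and cov: "asymptotic_covariance m P \<pi> \<Sigma>"
  shows "\<exists>g. (\<forall>i<m. g i - (\<Sum>l<m. P $$ (i, l) * g l) = f i - (\<Sum>j<m. \<pi> j * f j)) \<and>
    (\<Sum>i<m. \<Sum>j<m. f i * f j * \<Sigma> $$ (i, j)) =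
       (\<Sum>i<m. \<pi> i * ((g i)\<^sup>2 - (\<Sum>l<m. P $$ (i, l) * g l)\<^sup>2))"
proof -
  obtain w where w: "\<forall>i<m. \<forall>j<m. w i j - (\<Sum>l<m. P $$ (i, l) * w l j) = (if i = j then 1 else 0) - \<pi> j"
    "\<forall>j<m. (\<Sum>i<m. \<pi> i * w i j) = 0"
    "\<forall>i<m. \<forall>j<m. \<Sigma> $$ (i, j) = (if i = j then - \<pi> i else 0) + \<pi> i * \<pi> j + \<pi> i * w i j + \<pi> j * w j i"
    using covariance_via_real_potential[OF assms] by blast
  note w1 = w(1)[rule_format] and w2 = w(2)[rule_format] and w3 = w(3)[rule_format]
  define g where "g i = (\<Sum>j<m. w i j * f j)" for i
  define h where "h i = (\<Sum>l<m. P $$ (i, l) * g l)" for i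
  define c where "c = (\<Sum>j<m. \<pi> j * f j)"
  have gh: "g i - h i = f i - c" if i: "i < m" for i
  proof -
    have "h i = (\<Sum>j<m. \<Sum>l<m. P $$ (i, l) * w l j * f j)"
      unfolding h_def g_def sum_distrib_left by (subst sum.swap) (simp add: mult.assoc)
    then have "g i - h i = (\<Sum>j<m. (w i j - (\<Sum>l<m. P $$ (i, l) * w l j)) * f j)"
      unfolding g_def by (simp add: left_diff_distrib sum_subtractf sum_distrib_right)
    also have "\<dots> = (\<Sum>j<m. (if i = j then f j else 0) - \<pi> j * f j)"
      by (intro sum.cong refl) (auto simp: w1[OF i] left_diff_distrib)
    also have "\<dots> = f i - c"
      using i by (simp add: sum_subtractf c_def)
    finally show ?thesis .
  qed
  have pg: "(\<Sum>i<m. \<pi> i * g i) = 0"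
  proof -
    have "(\<Sum>i<m. \<pi> i * g i) = (\<Sum>j<m. (\<Sum>i<m. \<pi> i * w i j) * f j)"
      unfolding g_def sum_distrib_left sum_distrib_right by (subst sum.swap) (simp add: mult.assoc)
    then show ?thesis using w2 by simp
  qed
  have ph: "(\<Sum>i<m. \<pi> i * h i) = 0"
  proof -
    have "(\<Sum>i<m. \<pi> i * h i) = (\<Sum>j<m. (\<Sum>i<m. \<pi> i * P $$ (i, j)) * g j)"
      unfolding h_def sum_distrib_left sum_distrib_right by (subst sum.swap) (simp add: mult.assoc)
    also have "\<dots> = (\<Sum>j<m. \<pi> j * g j)"
      using stat by (simp add: stationary_distribution_def)
    finally show ?thesis using pg by simp
  qed
  have "(\<Sum>i<m. \<Sum>j<m. f i * f j * \<Sigma> $$ (i, j)) =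
    (\<Sum>i<m. \<Sum>j<m. (if i = j then - (\<pi> i * f i * f i) else 0) + (\<pi> i * f i) * (\<pi> j * f j)
      + \<pi> i * f i * (w i j * f j) + \<pi> j * f j * (w j i * f i))"
    using w3 by (intro sum.cong refl) (auto simp: algebra_simps)
  also have "\<dots> = (\<Sum>i<m. \<Sum>j<m. if i = j then - (\<pi> i * f i * f i) else 0)
      + (\<Sum>i<m. \<Sum>j<m. (\<pi> i * f i) * (\<pi> j * f j))
      + (\<Sum>i<m. \<Sum>j<m. \<pi> i * f i * (w i j * f j)) + (\<Sum>i<m. \<Sum>j<m. \<pi> j * f j * (w j i * f i))"
    by (simp only: sum.distrib)
  also have "(\<Sum>i<m. \<Sum>j<m. \<pi> j * f j * (w j i * f i)) = (\<Sum>i<m. \<Sum>j<m. \<pi> i * f i * (w i j * f j))"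
    by (rule sum.swap)
  also have "(\<Sum>i<m. \<Sum>j<m. \<pi> i * f i * (w i j * f j)) = (\<Sum>i<m. \<pi> i * f i * g i)"
    by (simp add: g_def sum_distrib_left)
  also have "(\<Sum>i<m. \<Sum>j<m. (\<pi> i * f i) * (\<pi> j * f j)) = c * c"
    unfolding c_def by (rule sum_product[symmetric])
  also have "(\<Sum>i<m. \<Sum>j<m. if i = j then - (\<pi> i * f i * f i) else 0) = (\<Sum>i<m. - (\<pi> i * f i * f i))"
    by simp
  finally have q: "(\<Sum>i<m. \<Sum>j<m. f i * f j * \<Sigma> $$ (i, j)) =
    (\<Sum>i<m. - (\<pi> i * f i * f i)) + c * c + (\<Sum>i<m. \<pi> i * f i * g i) + (\<Sum>i<m. \<pi> i * f i * g i)" .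
  have "(\<Sum>i<m. - (\<pi> i * f i * f i)) + (\<Sum>i<m. \<pi> i * f i * g i) + (\<Sum>i<m. \<pi> i * f i * g i) =
    (\<Sum>i<m. \<pi> i * ((g i)\<^sup>2 - (h i)\<^sup>2) + 2 * c * (\<pi> i * h i) - c * c * \<pi> i)"
    unfolding sum.distrib[symmetric]
  proof (rule sum.cong[OF refl])
    fix i assume "i \<in> {..<m}"
    then have f: "f i = g i - h i + c" using gh[of i] by simp
    show "- (\<pi> i * f i * f i) + \<pi> i * f i * g i + \<pi> i * f i * g i =
       \<pi> i * ((g i)\<^sup>2 - (h i)\<^sup>2) + 2 * c * (\<pi> i * h i) - c * c * \<pi> i"
      unfolding f by (simp add: algebra_simps power2_eq_square)
  qed
  also have "\<dots> = (\<Sum>i<m. \<pi> i * ((g i)\<^sup>2 - (h i)\<^sup>2)) + 2 * c * (\<Sum>i<m. \<pi> i * h i) - c * c * (\<Sum>i<m. \<pi> i)"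
    by (simp add: sum.distrib sum_subtractf sum_distrib_left)
  also have "(\<Sum>i<m. \<pi> i) = 1" using stat by (simp add: stationary_distribution_def)
  finally have "(\<Sum>i<m. \<Sum>j<m. f i * f j * \<Sigma> $$ (i, j)) = (\<Sum>i<m. \<pi> i * ((g i)\<^sup>2 - (h i)\<^sup>2))"
    using q ph by simp
  then show ?thesis
    using gh unfolding h_def c_def by blast
qed

text \<open>Jensen's inequality for each row of \<open>P\<close>, obtained from the nonnegative
  variance of \<open>g\<close> under that row, bounds (P g)^2 by P(g^2). Stationarity makes the
  \<pi>-means of P(g^2) and g^2 equal.\<close>

lemma covariance_nonneg:
  assumes m: "m \<ge> 1" and P: "stochastic_mat m P" and irr: "irreducible_chain m P"
    and stat: "stationary_distribution m P \<pi>" and cov: "asymptotic_covariance m P \<pi> \<Sigma>"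
  shows "(\<Sum>i<m. \<Sum>j<m. f i * f j * \<Sigma> $$ (i, j)) \<ge> 0"
proof -
  obtain g where g: "(\<Sum>i<m. \<Sum>j<m. f i * f j * \<Sigma> $$ (i, j)) =
       (\<Sum>i<m. \<pi> i * ((g i)\<^sup>2 - (\<Sum>l<m. P $$ (i, l) * g l)\<^sup>2))"
    using covariance_quadratic_form[OF assms] by blast
  define h where "h i = (\<Sum>l<m. P $$ (i, l) * g l)" for i
  have jensen: "(h i)\<^sup>2 \<le> (\<Sum>l<m. P $$ (i, l) * (g l)\<^sup>2)" if i: "i < m" for i
  proof -
    have "0 \<le> (\<Sum>l<m. P $$ (i, l) * (g l - h i)\<^sup>2)"
      using stochastic_matD(2)[OF P i] by (intro sum_nonneg mult_nonneg_nonneg) auto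
    also have "\<dots> = (\<Sum>l<m. P $$ (i, l) * (g l)\<^sup>2 - 2 * h i * (P $$ (i, l) * g l) + (h i)\<^sup>2 * P $$ (i, l))"
      by (intro sum.cong refl) (simp add: power2_eq_square algebra_simps)
    also have "\<dots> = (\<Sum>l<m. P $$ (i, l) * (g l)\<^sup>2) - 2 * h i * h i + (h i)\<^sup>2 * (\<Sum>l<m. P $$ (i, l))"
      unfolding h_def by (simp only: sum.distrib sum_subtractf sum_distrib_left)
    finally show ?thesis using stochastic_matD(3)[OF P i] by (simp add: power2_eq_square)
  qed
  have "(\<Sum>i<m. \<pi> i * (h i)\<^sup>2) \<le> (\<Sum>i<m. \<pi> i * (\<Sum>l<m. P $$ (i, l) * (g l)\<^sup>2))"
    using stat jensen by (intro sum_mono mult_left_mono) (auto simp: stationary_distribution_def)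
  also have "\<dots> = (\<Sum>l<m. (\<Sum>i<m. \<pi> i * P $$ (i, l)) * (g l)\<^sup>2)"
    unfolding sum_distrib_left sum_distrib_right by (subst sum.swap) (simp add: mult.assoc)
  also have "\<dots> = (\<Sum>l<m. \<pi> l * (g l)\<^sup>2)"
    using stat by (simp add: stationary_distribution_def)
  finally show ?thesis
    unfolding g by (simp add: h_def right_diff_distrib sum_subtractf)
qed

text \<open>For constant \<open>f\<close> the right-hand side of Poisson's equation is 0. Then P g =
  g and the squares cancel.\<close>

lemma total_covariance_zero:
  assumes m: "m \<ge> 1" and P: "stochastic_mat m P" and irr: "irreducible_chain m P"
    and stat: "stationary_distribution m P \<pi>" and cov: "asymptotic_covariance m P \<pi> \<Sigma>"
  shows "(\<Sum>i<m. \<Sum>j<m. \<Sigma> $$ (i, j)) = 0"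
proof -
  obtain g where g: "\<forall>i<m. g i - (\<Sum>l<m. P $$ (i, l) * g l) = 1 - (\<Sum>j<m. \<pi> j * 1)"
    "(\<Sum>i<m. \<Sum>j<m. 1 * 1 * \<Sigma> $$ (i, j)) =
       (\<Sum>i<m. \<pi> i * ((g i)\<^sup>2 - (\<Sum>l<m. P $$ (i, l) * g l)\<^sup>2))"
    using covariance_quadratic_form[OF assms, where f = "\<lambda>_. 1"] by blast
  have "(\<Sum>j<m. \<pi> j) = 1" using stat by (simp add: stationary_distribution_def)
  then have "(\<Sum>l<m. P $$ (i, l) * g l) = g i" if "i < m" for i using g(1)[rule_format, OF that] by simp
  then show ?thesis using g(2) by simp
qed

text \<open>The degenerate case of the Cauchy--Schwarz inequality: on the test vector with entry
  \<open>x\<close> at \<open>r\<close> and 1 at \<open>s\<close>, a nonnegative quadratic form with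
  zero coefficient at \<open>x^2\<close> is affine in \<open>x\<close>, so its slope must
  vanish.\<close>

lemma zero_variance_row:
  assumes m: "m \<ge> 1" and P: "stochastic_mat m P" and irr: "irreducible_chain m P"
    and stat: "stationary_distribution m P \<pi>" and cov: "asymptotic_covariance m P \<pi> \<Sigma>"
    and r: "r < m" "\<Sigma> $$ (r, r) = 0" and s: "s < m"
  shows "\<Sigma> $$ (r, s) = 0" "\<Sigma> $$ (s, r) = 0"
proof -
  obtain w where w: "\<forall>i<m. \<forall>j<m. \<Sigma> $$ (i, j) = (if i = j then - \<pi> i else 0) + \<pi> i * \<pi> j + \<pi> i * w i j + \<pi> j * w j i"
    using covariance_via_real_potential[OF assms(1-5)] by blast
  note w = w[rule_format]
  have sym: "\<Sigma> $$ (r, s) = \<Sigma> $$ (s, r)"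
    unfolding w[OF r(1) s] w[OF s r(1)] by simp
  have "\<Sigma> $$ (r, s) = 0"
  proof (cases "r = s")
    case False
    let ?a = "\<Sigma> $$ (s, s)" and ?b = "\<Sigma> $$ (r, s)"
    have nn: "?a + 2 * x * ?b \<ge> 0" for x
    proof -
      let ?f = "\<lambda>i. (if i = r then x else 0) + (if i = s then 1 else 0)"
      have inner: "(\<Sum>j<m. ?f i * ?f j * \<Sigma> $$ (i, j)) = ?f i * (x * \<Sigma> $$ (i, r) + \<Sigma> $$ (i, s))" for i
      proof -
        have "(\<Sum>j<m. ?f i * ?f j * \<Sigma> $$ (i, j)) =
          (\<Sum>j<m. (if j = r then ?f i * x * \<Sigma> $$ (i, r) else 0) + (if j = s then ?f i * \<Sigma> $$ (i, s) else 0))"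
          using False by (intro sum.cong refl) auto
        then show ?thesis using r s by (simp add: sum.distrib algebra_simps)
      qed
      have "0 \<le> (\<Sum>i<m. \<Sum>j<m. ?f i * ?f j * \<Sigma> $$ (i, j))"
        by (rule covariance_nonneg[OF assms(1-5)])
      also have "\<dots> = (\<Sum>i<m. (if i = r then x * (x * \<Sigma> $$ (r, r) + \<Sigma> $$ (r, s)) else 0)
          + (if i = s then x * \<Sigma> $$ (s, r) + \<Sigma> $$ (s, s) else 0))"
        unfolding inner using False by (intro sum.cong refl) auto
      also have "\<dots> = x * (x * \<Sigma> $$ (r, r) + \<Sigma> $$ (r, s)) + (x * \<Sigma> $$ (s, r) + \<Sigma> $$ (s, s))"
        using r s by (simp add: sum.distrib)
      finally show ?thesis using r sym by simp
    qed
    show ?thesis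
    proof (rule ccontr)
      assume b: "?b \<noteq> 0"
      \<comment> \<open>This \<open>x\<close> is chosen to give the affine function the value
        -1.\<close>
      have "?a + 2 * (- (?a + 1) / (2 * ?b)) * ?b = - 1" using b by (simp add: field_simps)
      then show False using nn[of "- (?a + 1) / (2 * ?b)"] by simp
    qed
  qed (use r in simp)
  then show "\<Sigma> $$ (r, s) = 0" "\<Sigma> $$ (s, r) = 0" using sym by auto
qed

text \<open>Dividing by standard deviations and multiplying back restores every entry. If one of
  them is 0, the quotient is 0 by the convention for division, and so is the original entry.\<close>

lemma rescaled_covariance_total:
  assumes m: "m \<ge> 1" and P: "stochastic_mat m P" and irr: "irreducible_chain m P"
    and stat: "stationary_distribution m P \<pi>" and cov: "asymptotic_covariance m P \<pi> \<Sigma>"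
  shows "(\<Sum>i<m. \<Sum>j<m. std_dev \<Sigma> i * std_dev \<Sigma> j * (\<Sigma> $$ (i, j) / (std_dev \<Sigma> i * std_dev \<Sigma> j))) = 0"
proof -
  have "std_dev \<Sigma> i * std_dev \<Sigma> j * (\<Sigma> $$ (i, j) / (std_dev \<Sigma> i * std_dev \<Sigma> j)) = \<Sigma> $$ (i, j)"
    if ij: "i < m" "j < m" for i j
    using zero_variance_row[OF assms ij(1) _ ij(2)] zero_variance_row[OF assms ij(2) _ ij(1)]
    by (auto simp: std_dev_def)
  then have "(\<Sum>i<m. \<Sum>j<m. std_dev \<Sigma> i * std_dev \<Sigma> j * (\<Sigma> $$ (i, j) / (std_dev \<Sigma> i * std_dev \<Sigma> j))) =
      (\<Sum>i<m. \<Sum>j<m. \<Sigma> $$ (i, j))"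
    by (intro sum.cong refl) auto
  then show ?thesis using total_covariance_zero[OF assms] by simp
qed

section \<open>Time reversal\<close>

text \<open>\<open>- Y (N - Suc p, i)\<close> is the \<open>p\<close>-th increment of coordinate
  \<open>i\<close> of the reversed path. The increments over equal steps are independent with a
  common centered Gaussian law, so permuting them in time and changing all signs preserves every
  linear combination in law; Cramer--Wold lifts this to the joint law.\<close>

lemma brownian_grid_law:
  fixes B :: "nat \<Rightarrow> real \<Rightarrow> 'a \<Rightarrow> real" and N :: nat
  assumes bm: "brownian_motion M m C B" and N: "N > 0"
  defines "Y \<equiv> (\<lambda>(p, i) \<omega>. B i (real (Suc p) / real N) \<omega> - B i (real p / real N) \<omega>)"
  shows "distr M (\<Pi>\<^sub>M k\<in>{..<N} \<times> {..<m}. borel) (\<lambda>\<omega>. \<lambda>k\<in>{..<N} \<times> {..<m}. Y k \<omega>) =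
    distr M (\<Pi>\<^sub>M k\<in>{..<N} \<times> {..<m}. borel) (\<lambda>\<omega>. \<lambda>k\<in>{..<N} \<times> {..<m}. - Y (N - Suc (fst k), snd k) \<omega>)"
proof -
  interpret prob_space M using bm by (simp add: brownian_motion_def)
  have M: "prob_space M" by unfold_locales
  have Bm: "B i (real q / real N) \<in> borel_measurable M" if "i < m" "q \<le> N" for i q
    using bm that N by (simp add: brownian_motion_def)
  have Ym: "Y (p, i) \<in> borel_measurable M" if "p < N" "i < m" for p i
    unfolding Y_def using Bm[of i "Suc p"] Bm[of i p] that by simp
  define V where "V c = (\<Sum>i<m. \<Sum>j<m. c i * c j * (1 / real N * C i j))" for c :: "nat \<Rightarrow> real"
  have law: "(CLINT \<omega>|M. iexp (\<Sum>p<N. \<Sum>i<m. c p i * Y (p, i) \<omega>)) = (\<Prod>p<N. char (centered_normal (V (c p))) 1)" for c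
  proof -
    have "indep_vars (\<lambda>_. \<Pi>\<^sub>M i\<in>{..<m}. borel)
      (\<lambda>k \<omega>. \<lambda>i\<in>{..<m}. B i (real (Suc k) / real N) \<omega> - B i (real k / real N) \<omega>) {..<N}"
    proof -
      have "\<forall>n t. 0 \<le> t 0 \<and> (\<forall>k<n. t k \<le> t (Suc k)) \<and> t n \<le> 1 \<longrightarrow>
        indep_vars (\<lambda>_. \<Pi>\<^sub>M i\<in>{..<m}. borel)
          (\<lambda>k \<omega>. \<lambda>i\<in>{..<m}. B i (t (Suc k)) \<omega> - B i (t k) \<omega>) {..<n}"
        using bm unfolding brownian_motion_def by blast
      from this[rule_format, of "\<lambda>q. real q / real N" N] show ?thesis
        using N by (simp add: divide_right_mono)
    qed
    then have "indep_vars (\<lambda>_. borel) (\<lambda>p \<omega>. (\<lambda>x. \<Sum>i<m. c p i * x i)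
      (\<lambda>i\<in>{..<m}. B i (real (Suc p) / real N) \<omega> - B i (real p / real N) \<omega>)) {..<N}"
      by (rule indep_vars_compose2) measurable
    then have ind: "indep_vars (\<lambda>_. borel) (\<lambda>p \<omega>. \<Sum>i<m. c p i * Y (p, i) \<omega>) {..<N}"
      by (simp add: Y_def)
    have Sm: "(\<lambda>\<omega>. \<Sum>i<m. c p i * Y (p, i) \<omega>) \<in> borel_measurable M" if "p < N" for p
      using Ym[OF that] by (intro borel_measurable_sum borel_measurable_times) auto
    have "(CLINT \<omega>|M. iexp (\<Sum>p<N. \<Sum>i<m. c p i * Y (p, i) \<omega>)) =
        char (distr M borel (\<lambda>\<omega>. \<Sum>p<N. \<Sum>i<m. c p i * Y (p, i) \<omega>)) 1"
      by (subst char_distr) (auto intro!: borel_measurable_sum Sm)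
    also have "\<dots> = (\<Prod>p<N. char (distr M borel (\<lambda>\<omega>. \<Sum>i<m. c p i * Y (p, i) \<omega>)) 1)"
      by (rule char_distr_sum[OF ind])
    also have "\<dots> = (\<Prod>p<N. char (centered_normal (V (c p))) 1)"
    proof (rule prod.cong[OF refl])
      fix p assume p: "p \<in> {..<N}"
      have "\<forall>s t. 0 \<le> s \<and> s \<le> t \<and> t \<le> 1 \<longrightarrow>
        centered_gaussian_vector M m (\<lambda>i j. (t - s) * C i j) (\<lambda>i \<omega>. B i t \<omega> - B i s \<omega>)"
        using bm unfolding brownian_motion_def by blast
      from this[rule_format, of "real p / real N" "real (Suc p) / real N"]
      have "centered_gaussian_vector M m (\<lambda>i j. (real (Suc p) / real N - real p / real N) * C i j)
         (\<lambda>i \<omega>. Y (p, i) \<omega>)"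
        using p N by (simp add: divide_right_mono Y_def)
      moreover have "real (Suc p) / real N - real p / real N = 1 / real N"
        by (simp add: diff_divide_distrib[symmetric])
      ultimately have "centered_gaussian_vector M m (\<lambda>i j. 1 / real N * C i j) (\<lambda>i \<omega>. Y (p, i) \<omega>)"
        by simp
      then show "char (distr M borel (\<lambda>\<omega>. \<Sum>i<m. c p i * Y (p, i) \<omega>)) 1 = char (centered_normal (V (c p))) 1"
        unfolding centered_gaussian_vector_def V_def by simp
    qed
    finally show ?thesis .
  qed
  let ?K = "{..<N} \<times> {..<m}"
  show ?thesis
  proof (rule Cramer_Wold[OF M M])
    show "finite ?K" by simp
    show "Y k \<in> borel_measurable M" if "k \<in> ?K" for k using that Ym by auto
    show "(\<lambda>\<omega>. - Y (N - Suc (fst k), snd k) \<omega>) \<in> borel_measurable M" if "k \<in> ?K" for k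
      using that Ym[of "N - Suc (fst k)" "snd k"] by auto
    fix c :: "nat \<times> nat \<Rightarrow> real"
    \<comment> \<open>Sign and reversal are moved from the increments to the coefficients. The sign
      drops out since \<open>V\<close> is quadratic, and the reversal only permutes the factors of
      the product.\<close>
    define e where "e p i = - c (N - Suc p, i)" for p i
    have V: "V (e p) = V (\<lambda>i. c (N - Suc p, i))" for p
      unfolding V_def e_def by simp
    have "(CLINT \<omega>|M. iexp (\<Sum>k\<in>?K. c k * Y k \<omega>)) = (\<Prod>p<N. char (centered_normal (V (\<lambda>i. c (p, i)))) 1)"
      unfolding law[symmetric] by (simp only: sum.cartesian_product) (simp add: split_def)
    also have "\<dots> = (\<Prod>p<N. char (centered_normal (V (\<lambda>i. c (N - Suc p, i)))) 1)"
      by (rule prod.nat_diff_reindex[symmetric])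
    also have "\<dots> = (\<Prod>p<N. char (centered_normal (V (e p))) 1)"
      by (simp only: V)
    also have "\<dots> = (CLINT \<omega>|M. iexp (\<Sum>p<N. \<Sum>i<m. e p i * Y (p, i) \<omega>))"
      by (rule law[symmetric])
    also have "\<dots> = (CLINT \<omega>|M. iexp (\<Sum>k\<in>?K. c k * - Y (N - Suc (fst k), snd k) \<omega>))"
    proof -
      have "(\<Sum>p<N. \<Sum>i<m. e p i * Y (p, i) \<omega>) = (\<Sum>k\<in>?K. c k * - Y (N - Suc (fst k), snd k) \<omega>)" for \<omega>
      proof -
        have "(\<Sum>p<N. \<Sum>i<m. e p i * Y (p, i) \<omega>) = (\<Sum>p<N. \<Sum>i<m. e (N - Suc p) i * Y (N - Suc p, i) \<omega>)"
          by (rule sum.nat_diff_reindex[symmetric])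
        also have "\<dots> = (\<Sum>p<N. \<Sum>i<m. c (p, i) * - Y (N - Suc p, i) \<omega>)"
          by (intro sum.cong refl) (auto simp: e_def Suc_diff_Suc)
        also have "\<dots> = (\<Sum>k\<in>?K. c k * - Y (N - Suc (fst k), snd k) \<omega>)"
          by (simp only: sum.cartesian_product) (simp add: split_def)
        finally show ?thesis .
      qed
      then show ?thesis by simp
    qed
    finally show "(CLINT \<omega>|M. iexp (\<Sum>k\<in>?K. c k * Y k \<omega>)) =
      (CLINT \<omega>|M. iexp (\<Sum>k\<in>?K. c k * - Y (N - Suc (fst k), snd k) \<omega>))" .
  qed
qed

lemma brownian_path:
  assumes "brownian_motion M m C B" "i < m" "\<omega> \<in> space M"
  shows "B i 0 \<omega> = 0" "continuous_on {0..1} (\<lambda>t. B i t \<omega>)"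
  using assms by (auto simp: brownian_motion_def)

text \<open>One form for both sides of the claim: \<open>A\<close> holds the ranks below or above
  the block of ties, \<open>k\<close> is the rank just before the block, \<open>d\<close> its length
  and \<open>s\<close> the number of paths in it.\<close>

definition path_functional ::
    "(nat \<Rightarrow> nat) \<Rightarrow> (nat \<Rightarrow> real) \<Rightarrow> nat set \<Rightarrow> nat \<Rightarrow> nat \<Rightarrow> nat \<Rightarrow> (nat \<Rightarrow> real \<Rightarrow> real) \<Rightarrow> real" where
  "path_functional \<tau> \<sigma> A k s d Z = (\<Sum>i\<in>A. \<sigma> (\<tau> i) * Z (\<tau> i) 1) +
     max_path_sum s d (\<lambda>l t. \<sigma> (\<tau> (k + l)) * Z (\<tau> (k + l)) t)"

text \<open>
  On the grid of mesh \<open>1 / N\<close> the functional is a fixed measurable function of the increments,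
  and reversing time permutes the increments and changes their sign.
\<close>

lemma path_functional_reversal:
  fixes \<tau> :: "nat \<Rightarrow> nat" and \<sigma> :: "nat \<Rightarrow> real" and B :: "nat \<Rightarrow> real \<Rightarrow> 'a \<Rightarrow> real"
  assumes bm: "brownian_motion M m C B" and sd: "s \<le> d"
    and A: "finite A" "\<And>i. i \<in> A \<Longrightarrow> \<tau> i < m" and k: "\<And>l. l \<in> {1..d} \<Longrightarrow> \<tau> (k + l) < m"
  defines "F \<equiv> (\<lambda>\<omega>. path_functional \<tau> \<sigma> A k s d (\<lambda>i t. B i t \<omega>))"
    and "F' \<equiv> (\<lambda>\<omega>. path_functional \<tau> \<sigma> A k s d (reversed (\<lambda>i t. B i t \<omega>)))"
  shows "F \<in> borel_measurable M" "F' \<in> borel_measurable M" "distr M borel F = distr M borel F'"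
proof -
  have M: "prob_space M" using bm by (simp add: brownian_motion_def)
  define G where "G N Z = (\<Sum>i\<in>A. \<sigma> (\<tau> i) * Z (\<tau> i) 1) +
      Max (path_sum s d (\<lambda>l t. \<sigma> (\<tau> (k + l)) * Z (\<tau> (k + l)) t) ` grid_arrays (Suc N) s d)" for N Z
  have lim: "(\<lambda>N. G N Z) \<longlonglongrightarrow> path_functional \<tau> \<sigma> A k s d Z"
    if "\<And>i. i < m \<Longrightarrow> continuous_on {0..1} (Z i)" for Z
    unfolding G_def path_functional_def
    by (intro tendsto_add tendsto_const max_path_sum_grid_limit[OF sd] continuous_on_mult
        continuous_on_const that k)
  define K where "K N = {..<Suc N} \<times> {..<m}" for N
  \<comment> \<open>Partial sums of the increments recover the path at grid times. Between them the
    result is a step function, which is harmless because \<open>G N\<close> evaluates paths at grid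
    times only.\<close>
  define rebuild where "rebuild N x i t = (\<Sum>p<nat \<lfloor>t * real (Suc N)\<rfloor>. x (p, i))"
    for N and x :: "nat \<times> nat \<Rightarrow> real" and i and t :: real
  have nat_floor: "nat \<lfloor>real q / real (Suc N) * real (Suc N)\<rfloor> = q" for q N
    by (simp del: of_nat_Suc)
  have nat_floor1: "nat \<lfloor>1 * real (Suc N)\<rfloor> = Suc N" for N
    by (simp del: of_nat_Suc)
  have G_cong: "G N Z = G N Z'"
    if "\<And>i q. i < m \<Longrightarrow> q \<le> Suc N \<Longrightarrow> Z i (real q / real (Suc N)) = Z' i (real q / real (Suc N))" for N Z Z'
  proof -
    have one: "Z i 1 = Z' i 1" if "i < m" for i
      using that \<open>\<And>i q. i < m \<Longrightarrow> q \<le> Suc N \<Longrightarrow> Z i (real q / real (Suc N)) = Z' i (real q / real (Suc N))\<close>[of i "Suc N"]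
      by (simp del: of_nat_Suc)
    have "path_sum s d (\<lambda>l t. \<sigma> (\<tau> (k + l)) * Z (\<tau> (k + l)) t) t =
        path_sum s d (\<lambda>l t. \<sigma> (\<tau> (k + l)) * Z' (\<tau> (k + l)) t) t"
      if t: "t \<in> grid_arrays (Suc N) s d" for t
      unfolding path_sum_def
    proof (intro sum.cong refl)
      fix j l assume jl: "j \<in> {1..s}" "l \<in> {j..d - s + j}"
      then have l: "l \<in> {1..d}" using sd by auto
      have "Z (\<tau> (k + l)) (t (j, a)) = Z' (\<tau> (k + l)) (t (j, a))" if a: "a \<le> d" for a
      proof -
        obtain q where "q \<le> Suc N" "t (j, a) = real q / real (Suc N)"
          using t jl(1) a unfolding grid_arrays_def by fastforce
        then show ?thesis using that(1) \<open>\<And>i q. i < m \<Longrightarrow> q \<le> Suc N \<Longrightarrow> Z i (real q / real (Suc N)) = Z' i (real q / real (Suc N))\<close> k[OF l] by metis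
      qed
      note * = this
      have "l \<le> d" "l - 1 \<le> d" using l by auto
      note e = this[THEN *]
      show "\<sigma> (\<tau> (k + l)) * Z (\<tau> (k + l)) (t (j, l)) - \<sigma> (\<tau> (k + l)) * Z (\<tau> (k + l)) (t (j, l - 1)) =
        \<sigma> (\<tau> (k + l)) * Z' (\<tau> (k + l)) (t (j, l)) - \<sigma> (\<tau> (k + l)) * Z' (\<tau> (k + l)) (t (j, l - 1))"
        by (simp only: e)
    qed
    then show ?thesis
      unfolding G_def using one A(2) by (intro arg_cong2[where f = "(+)"] sum.cong arg_cong[where f = Max] image_cong) auto
  qed
  have Gm: "(\<lambda>x. G N (rebuild N x)) \<in> borel_measurable (\<Pi>\<^sub>M k\<in>K N. borel)" for N
  proof -
    have rm: "(\<lambda>x. rebuild N x i t) \<in> borel_measurable (\<Pi>\<^sub>M k\<in>K N. borel)"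
      if "i < m" "nat \<lfloor>t * real (Suc N)\<rfloor> \<le> Suc N" for i t
      unfolding rebuild_def
    proof (rule borel_measurable_sum)
      fix p assume "p \<in> {..<nat \<lfloor>t * real (Suc N)\<rfloor>}"
      then have "(p, i) \<in> K N" using that unfolding K_def by auto
      then show "(\<lambda>x. x (p, i)) \<in> borel_measurable (\<Pi>\<^sub>M k\<in>K N. borel)"
        by (rule measurable_component_singleton)
    qed
    show ?thesis
      unfolding G_def
    proof (intro borel_measurable_add borel_measurable_sum borel_measurable_times borel_measurable_const)
      fix i assume "i \<in> A"
      then show "(\<lambda>x. rebuild N x (\<tau> i) 1) \<in> borel_measurable (\<Pi>\<^sub>M k\<in>K N. borel)"
        by (intro rm A(2)) (simp_all only: nat_floor1)
    next
      show "(\<lambda>x. Max (path_sum s d (\<lambda>l t. \<sigma> (\<tau> (k + l)) * rebuild N x (\<tau> (k + l)) t) ` grid_arrays (Suc N) s d))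
        \<in> borel_measurable (\<Pi>\<^sub>M k\<in>K N. borel)"
      proof (rule borel_measurable_Max[OF finite_grid_arrays])
        fix t assume t: "t \<in> grid_arrays (Suc N) s d"
        show "(\<lambda>x. path_sum s d (\<lambda>l t. \<sigma> (\<tau> (k + l)) * rebuild N x (\<tau> (k + l)) t) t)
          \<in> borel_measurable (\<Pi>\<^sub>M k\<in>K N. borel)"
          unfolding path_sum_def
        proof (intro borel_measurable_sum borel_measurable_diff borel_measurable_times borel_measurable_const)
          fix j l assume jl: "j \<in> {1..s}" "l \<in> {j..d - s + j}"
          then have l: "l \<in> {1..d}" using sd by auto
          have *: "(\<lambda>x. rebuild N x (\<tau> (k + l)) (t (j, a))) \<in> borel_measurable (\<Pi>\<^sub>M k\<in>K N. borel)" if a: "a \<le> d" for a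
          proof -
            obtain q where "q \<le> Suc N" "t (j, a) = real q / real (Suc N)"
              using t jl(1) a unfolding grid_arrays_def by fastforce
            then show ?thesis by (intro rm k l) (simp only: nat_floor)
          qed
          have "l \<le> d" "l - 1 \<le> d" using l by auto
          from this[THEN *] show
            "(\<lambda>x. rebuild N x (\<tau> (k + l)) (t (j, l))) \<in> borel_measurable (\<Pi>\<^sub>M k\<in>K N. borel)"
            "(\<lambda>x. rebuild N x (\<tau> (k + l)) (t (j, l - 1))) \<in> borel_measurable (\<Pi>\<^sub>M k\<in>K N. borel)" .
        qed
      qed
    qed
  qed
  define Y where "Y N = (\<lambda>(p, i) \<omega>. B i (real (Suc p) / real (Suc N)) \<omega> - B i (real p / real (Suc N)) \<omega>)" for N
  define x where "x N \<omega> = (\<lambda>k\<in>K N. Y N k \<omega>)" for N \<omega>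
  define x' where "x' N \<omega> = (\<lambda>k\<in>K N. - Y N (Suc N - Suc (fst k), snd k) \<omega>)" for N \<omega>
  have Bm: "B i (real q / real (Suc N)) \<in> borel_measurable M" if "i < m" "q \<le> Suc N" for i q N
    using bm that unfolding brownian_motion_def by (simp del: of_nat_Suc)
  have Ym: "Y N (p, i) \<in> borel_measurable M" if "p < Suc N" "i < m" for N p i
    unfolding Y_def using Bm[of i "Suc p" N] Bm[of i p N] that by simp
  have xm: "x N \<in> measurable M (\<Pi>\<^sub>M k\<in>K N. borel)" for N
    unfolding x_def by (rule measurable_restrict) (use Ym in \<open>auto simp: K_def\<close>)
  have x'm: "x' N \<in> measurable M (\<Pi>\<^sub>M k\<in>K N. borel)" for N
    unfolding x'_def by (rule measurable_restrict) (use Ym in \<open>auto simp: K_def\<close>)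
  have xlaw: "distr M (\<Pi>\<^sub>M k\<in>K N. borel) (x N) = distr M (\<Pi>\<^sub>M k\<in>K N. borel) (x' N)" for N
    using brownian_grid_law[OF bm, of "Suc N"] unfolding x_def x'_def K_def Y_def by simp
  have Gx: "G N (rebuild N (x N \<omega>)) = G N (\<lambda>i t. B i t \<omega>)" if \<omega>: "\<omega> \<in> space M" for N \<omega>
  proof (rule G_cong)
    fix i q assume iq: "i < m" "q \<le> Suc N"
    have "rebuild N (x N \<omega>) i (real q / real (Suc N)) = (\<Sum>p<q. Y N (p, i) \<omega>)"
      unfolding rebuild_def nat_floor x_def using iq by (intro sum.cong) (auto simp: K_def)
    also have "\<dots> = B i (real q / real (Suc N)) \<omega> - B i (real 0 / real (Suc N)) \<omega>"
      unfolding Y_def prod.case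
      using sum_lessThan_telescope[of "\<lambda>p. B i (real p / real (Suc N)) \<omega>" q] by (simp del: of_nat_Suc)
    finally show "rebuild N (x N \<omega>) i (real q / real (Suc N)) = B i (real q / real (Suc N)) \<omega>"
      using brownian_path(1)[OF bm iq(1) \<omega>] by simp
  qed
  have Gx': "G N (rebuild N (x' N \<omega>)) = G N (reversed (\<lambda>i t. B i t \<omega>))" if \<omega>: "\<omega> \<in> space M" for N \<omega>
  proof (rule G_cong)
    fix i q assume iq: "i < m" "q \<le> Suc N"
    \<comment> \<open>The path at grid times read backwards from time 1; the negated, reordered
      increments telescope along it.\<close>
    let ?b = "\<lambda>p. B i (real (Suc N - p) / real (Suc N)) \<omega>"
    have "rebuild N (x' N \<omega>) i (real q / real (Suc N)) = (\<Sum>p<q. - Y N (Suc N - Suc p, i) \<omega>)"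
      unfolding rebuild_def nat_floor x'_def using iq by (intro sum.cong) (auto simp: K_def)
    also have "\<dots> = (\<Sum>p<q. ?b (Suc p) - ?b p)"
    proof (rule sum.cong[OF refl])
      fix p assume "p \<in> {..<q}"
      then have "Suc (Suc N - Suc p) = Suc N - p" using iq by auto
      then show "- Y N (Suc N - Suc p, i) \<omega> = ?b (Suc p) - ?b p"
        unfolding Y_def prod.case by (simp del: of_nat_Suc diff_Suc_Suc)
    qed
    also have "\<dots> = ?b q - ?b 0" by (rule sum_lessThan_telescope)
    also have "\<dots> = reversed (\<lambda>i t. B i t \<omega>) i (real q / real (Suc N))"
    proof -
      have "real (Suc N - q) / real (Suc N) = 1 - real q / real (Suc N)"
        using iq by (simp add: of_nat_diff diff_divide_distrib del: of_nat_Suc)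
      then show ?thesis unfolding reversed_def by (simp del: of_nat_Suc)
    qed
    finally show "rebuild N (x' N \<omega>) i (real q / real (Suc N)) = reversed (\<lambda>i t. B i t \<omega>) i (real q / real (Suc N))" .
  qed
  have fm: "(\<lambda>\<omega>. G N (rebuild N (x N \<omega>))) \<in> borel_measurable M" for N
    using measurable_comp[OF xm Gm, of N] by (simp add: comp_def)
  have gm: "(\<lambda>\<omega>. G N (rebuild N (x' N \<omega>))) \<in> borel_measurable M" for N
    using measurable_comp[OF x'm Gm, of N] by (simp add: comp_def)
  have flim: "(\<lambda>N. G N (rebuild N (x N \<omega>))) \<longlonglongrightarrow> F \<omega>" if \<omega>: "\<omega> \<in> space M" for \<omega>
    unfolding Gx[OF \<omega>] F_def by (intro lim brownian_path(2)[OF bm _ \<omega>])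
  have glim: "(\<lambda>N. G N (rebuild N (x' N \<omega>))) \<longlonglongrightarrow> F' \<omega>" if \<omega>: "\<omega> \<in> space M" for \<omega>
    unfolding Gx'[OF \<omega>] F'_def by (intro lim continuous_on_reversed brownian_path(2)[OF bm _ \<omega>])
  show "F \<in> borel_measurable M" by (rule borel_measurable_LIMSEQ_real[OF flim fm])
  show "F' \<in> borel_measurable M" by (rule borel_measurable_LIMSEQ_real[OF glim gm])
  have "distr M borel (\<lambda>\<omega>. G N (rebuild N (x N \<omega>))) = distr M borel (\<lambda>\<omega>. G N (rebuild N (x' N \<omega>)))" for N
  proof -
    have "distr M borel (\<lambda>\<omega>. G N (rebuild N (x N \<omega>))) =
        distr (distr M (\<Pi>\<^sub>M k\<in>K N. borel) (x N)) borel (\<lambda>x. G N (rebuild N x))"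
      using distr_distr[OF Gm xm, of N] by (simp add: comp_def)
    also have "\<dots> = distr M borel (\<lambda>\<omega>. G N (rebuild N (x' N \<omega>)))"
      unfolding xlaw using distr_distr[OF Gm x'm, of N] by (simp add: comp_def)
    finally show ?thesis .
  qed
  from distr_eq_limit[OF M fm gm flim glim this] show "distr M borel F = distr M borel F'" .
qed

text \<open>A Gaussian combination of variance 0 has as its law the point mass at 0, by the first
  branch of \<open>centered_normal\<close>.\<close>

lemma centered_brownian_total:
  assumes bm: "brownian_motion M m C B"
    and C: "(\<Sum>i<m. \<Sum>j<m. a i * a j * C i j) = 0"
  shows "AE \<omega> in M. (\<Sum>i<m. a i * B i 1 \<omega>) = 0"
proof -
  have "\<forall>s t. 0 \<le> s \<and> s \<le> t \<and> t \<le> 1 \<longrightarrow>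
    centered_gaussian_vector M m (\<lambda>i j. (t - s) * C i j) (\<lambda>i \<omega>. B i t \<omega> - B i s \<omega>)"
    using bm unfolding brownian_motion_def by blast
  from this[rule_format, of 0 1]
  have "centered_gaussian_vector M m C (\<lambda>i \<omega>. B i 1 \<omega> - B i 0 \<omega>)" by simp
  then have D: "distr M borel (\<lambda>\<omega>. \<Sum>i<m. a i * (B i 1 \<omega> - B i 0 \<omega>)) = return borel 0"
    and meas: "\<And>i. i < m \<Longrightarrow> (\<lambda>\<omega>. B i 1 \<omega> - B i 0 \<omega>) \<in> borel_measurable M"
    unfolding centered_gaussian_vector_def by (simp_all add: C centered_normal_def)
  have "AE y in return borel (0::real). y = 0" by (subst AE_return) auto
  then have "AE \<omega> in M. (\<Sum>i<m. a i * (B i 1 \<omega> - B i 0 \<omega>)) = 0"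
    unfolding D[symmetric]
    by (subst (asm) AE_distr_iff) (auto intro!: borel_measurable_sum borel_measurable_times meas)
  then show ?thesis
    using AE_space
  proof eventually_elim
    case (elim \<omega>)
    have "(\<Sum>i<m. a i * B i 1 \<omega>) = (\<Sum>i<m. a i * (B i 1 \<omega> - B i 0 \<omega>))"
      using brownian_path(1)[OF bm _ elim(2)] by (intro sum.cong) auto
    then show ?case using elim(1) by simp
  qed
qed

section \<open>The block of ties and the two functionals\<close>

lemma rank_bounds:
  assumes \<tau>: "sorting_permutation m \<pi> \<tau>" and r: "1 \<le> r" "r \<le> m"
  shows "m_above m \<pi> \<tau> r < r" "r \<le> m_above m \<pi> \<tau> r + d_mult m \<pi> \<tau> r"
    "m_above m \<pi> \<tau> r + d_mult m \<pi> \<tau> r \<le> m"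
proof -
  define k where "k = m_above m \<pi> \<tau> r"
  have bij: "bij_betw \<tau> {1..m} {0..<m}" using \<tau> by (simp add: sorting_permutation_def)
  have step: "\<pi> (\<tau> (Suc i)) \<le> \<pi> (\<tau> i)" if "1 \<le> i" "i < m" for i
    using \<tau> that by (simp add: sorting_permutation_def)
  have anti: "\<pi> (\<tau> j) \<le> \<pi> (\<tau> i)" if "i \<le> j" "1 \<le> i" "j \<le> m" for i j
    using that
  proof (induction j rule: dec_induct)
    case (step n)
    then show ?case using \<open>\<And>i. 1 \<le> i \<Longrightarrow> i < m \<Longrightarrow> \<pi> (\<tau> (Suc i)) \<le> \<pi> (\<tau> i)\<close>[of n] by linarith
  qed simp
  let ?A = "{i \<in> {1..m}. \<pi> (\<tau> i) > \<pi> (\<tau> r)}"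
  \<comment> \<open>As \<pi> is nonincreasing along \<tau>, the ranks of strictly larger probability
    form an initial segment \<open>{1..k}\<close>. Both branches of \<open>m_above\<close> are
    covered: in the first the segment is empty.\<close>
  have k: "k < r \<and> (\<forall>i\<in>{1..m}. \<pi> (\<tau> i) > \<pi> (\<tau> r) \<longleftrightarrow> i \<le> k)"
  proof (cases "\<pi> (\<tau> r) = \<pi> (\<tau> 1)")
    case True
    then have "k = 0" by (simp add: k_def m_above_def)
    then show ?thesis using anti[of 1] True r by fastforce
  next
    case False
    then have kM: "k = Max ?A" by (simp add: k_def m_above_def)
    have "1 \<in> ?A" using anti[of 1 r] False r by auto
    then have "Max ?A \<in> ?A" by (intro Max_in) auto
    then have kA: "k \<in> {1..m}" "\<pi> (\<tau> k) > \<pi> (\<tau> r)" unfolding kM by auto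
    have "k < r"
    proof (rule ccontr)
      assume "\<not> k < r"
      then show False using anti[of r k] kA r by auto
    qed
    moreover have "\<pi> (\<tau> i) > \<pi> (\<tau> r) \<longleftrightarrow> i \<le> k" if "i \<in> {1..m}" for i
    proof
      assume "\<pi> (\<tau> i) > \<pi> (\<tau> r)"
      then show "i \<le> k" unfolding kM using that by (intro Max_ge) auto
    next
      assume "i \<le> k"
      then show "\<pi> (\<tau> i) > \<pi> (\<tau> r)" using anti[of i k] kA that by auto
    qed
    ultimately show ?thesis by blast
  qed
  have kiff: "\<pi> (\<tau> i) > \<pi> (\<tau> r) \<longleftrightarrow> i \<le> k" if "i \<in> {1..m}" for i using k that by blast
  \<comment> \<open>The tied ranks, which \<tau> carries onto the letters counted by
    \<open>d_mult\<close>. They contain \<open>{k + 1..r}\<close> and lie in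
    \<open>{k + 1..m}\<close>; the two inclusions give the two bounds on
    \<open>k + d\<close>.\<close>
  define T where "T = {i \<in> {1..m}. \<pi> (\<tau> i) = \<pi> (\<tau> r)}"
  have "\<tau> ` T = {i. i < m \<and> \<pi> i = \<pi> (\<tau> r)}"
  proof (rule subset_antisym; rule subsetI)
    fix i assume "i \<in> \<tau> ` T"
    then obtain j where "j \<in> {1..m}" "\<pi> (\<tau> j) = \<pi> (\<tau> r)" "i = \<tau> j" by (auto simp: T_def)
    then show "i \<in> {i. i < m \<and> \<pi> i = \<pi> (\<tau> r)}" using bij_betwE[OF bij] by simp
  next
    fix i assume i: "i \<in> {i. i < m \<and> \<pi> i = \<pi> (\<tau> r)}"
    then have "i \<in> \<tau> ` {1..m}" using bij_betw_imp_surj_on[OF bij] by simp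
    then obtain j where "j \<in> {1..m}" "i = \<tau> j" by (rule imageE)
    then show "i \<in> \<tau> ` T" using i by (simp add: T_def)
  qed
  moreover have "inj_on \<tau> T"
    using bij_betw_imp_inj_on[OF bij] by (rule inj_on_subset) (auto simp: T_def)
  ultimately have d: "d_mult m \<pi> \<tau> r = card T"
    unfolding d_mult_def using card_image[of \<tau> T] by simp
  have "T \<subseteq> {k + 1..m}"
  proof
    fix i assume i: "i \<in> T"
    then have "i \<in> {1..m}" "\<pi> (\<tau> i) = \<pi> (\<tau> r)" by (auto simp: T_def)
    then have "\<not> i \<le> k" using kiff[of i] by simp
    then show "i \<in> {k + 1..m}" using i by (simp add: T_def)
  qed
  then have "card T \<le> m - k" using card_mono[of "{k + 1..m}" T] by simp
  moreover have "{k + 1..r} \<subseteq> T"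
  proof
    fix i assume i: "i \<in> {k + 1..r}"
    then have "\<not> \<pi> (\<tau> i) > \<pi> (\<tau> r)" using kiff[of i] r by simp
    moreover have "\<pi> (\<tau> r) \<le> \<pi> (\<tau> i)" using anti[of i r] i r by auto
    ultimately show "i \<in> T" using i r by (auto simp: T_def)
  qed
  then have "r - k \<le> card T" using card_mono[of T "{k + 1..r}"] by (simp add: T_def)
  ultimately show "m_above m \<pi> \<tau> r < r" "r \<le> m_above m \<pi> \<tau> r + d_mult m \<pi> \<tau> r"
    "m_above m \<pi> \<tau> r + d_mult m \<pi> \<tau> r \<le> m"
    using k r unfolding d k_def[symmetric] by auto
qed

text \<open>With no paths the only value is the empty sum, so the separate case
  \<open>m\<^sub>r + d\<^sub>r = r\<close> of \<open>V_high\<close> agrees with the general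
  formula.\<close>

lemma max_path_sum_0: "max_path_sum 0 d X = 0"
  unfolding max_path_sum_def path_sum_def using I_set_nonempty[of 0 d]
  by (intro Greatest_equality) auto

lemma V_low_eq:
  assumes "m_above m \<pi> \<tau> r < r" "r \<le> m_above m \<pi> \<tau> r + d_mult m \<pi> \<tau> r"
  defines "k \<equiv> m_above m \<pi> \<tau> r" and "d \<equiv> d_mult m \<pi> \<tau> r"
  shows "V_low m \<pi> \<tau> \<sigma> B r \<omega> = path_functional \<tau> \<sigma> {1..k} k (r - k) d (\<lambda>i t. B i t \<omega>)"
proof -
  have "k + d - r = d - (r - k)" using assms by simp
  then show ?thesis
    unfolding V_low_def path_functional_def max_path_sum_def path_sum_def k_def[symmetric] d_def[symmetric] Let_def
    by (simp only: right_diff_distrib)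
qed

lemma V_high_eq:
  assumes "m_above m \<pi> \<tau> r < r" "r \<le> m_above m \<pi> \<tau> r + d_mult m \<pi> \<tau> r"
  defines "k \<equiv> m_above m \<pi> \<tau> r" and "d \<equiv> d_mult m \<pi> \<tau> r"
  shows "V_high m \<pi> \<tau> \<sigma> B r \<omega> =
    path_functional \<tau> \<sigma> {k + d + 1..m} k (d - (r - k)) d (\<lambda>i t. B i t \<omega>)"
proof (cases "k + d = r")
  case True
  then have "d - (r - k) = 0" by simp
  then show ?thesis using True
    unfolding V_high_def path_functional_def k_def[symmetric] d_def[symmetric] Let_def
    by (simp add: max_path_sum_0)
next
  case False
  \<comment> \<open>The second identity is the summation bound: with \<open>d - (r - k)\<close>
    paths, row \<open>j\<close> ends at letter \<open>r - k + j\<close>. It relies on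
    \<open>r - k \<le> d\<close>, without which the subtraction would truncate.\<close>
  have "k + d - r = d - (r - k)" "r - k = d - (d - (r - k))" using assms by auto
  then show ?thesis using False
    unfolding V_high_def path_functional_def max_path_sum_def path_sum_def k_def[symmetric] d_def[symmetric] Let_def
    by (simp only: right_diff_distrib if_False)
qed

text \<open>
  Complementation turns the lower functional into the upper one of the time-reversed paths, up to
  the total \<open>\<Sum>\<^sub>i \<sigma>\<^sub>i B\<^sup>i(1)\<close>, which vanishes almost surely because the entries of \<open>\<Sigma>\<close> sum to 0.
\<close>

lemma path_functional_complement:
  assumes \<tau>: "bij_betw \<tau> {1..m} {0..<m}" and sd: "s \<le> d" and kd: "k + d \<le> m"
    and Z0: "\<And>i. i < m \<Longrightarrow> Z i 0 = 0" and Z: "\<And>i. i < m \<Longrightarrow> continuous_on {0..1} (Z i)"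
    and total: "(\<Sum>i<m. \<sigma> i * Z i 1) = 0"
  shows "path_functional \<tau> \<sigma> {1..k} k s d Z = path_functional \<tau> \<sigma> {k + d + 1..m} k (d - s) d (reversed Z)"
proof -
  define f where "f i = \<sigma> (\<tau> i) * Z (\<tau> i) 1" for i
  have \<tau>m: "\<tau> i < m" if "i \<in> {1..m}" for i using bij_betwE[OF \<tau>] that by auto
  let ?X = "\<lambda>l t. \<sigma> (\<tau> (k + l)) * Z (\<tau> (k + l)) t"
  have "(\<lambda>l t. \<sigma> (\<tau> (k + l)) * reversed Z (\<tau> (k + l)) t) = reversed ?X"
    by (simp add: reversed_def fun_eq_iff right_diff_distrib)
  then have "path_functional \<tau> \<sigma> {k + d + 1..m} k (d - s) d (reversed Z) =
      (\<Sum>i=k + d + 1..m. \<sigma> (\<tau> i) * reversed Z (\<tau> i) 1) + max_path_sum (d - s) d (reversed ?X)"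
    by (simp add: path_functional_def)
  also have "(\<Sum>i=k + d + 1..m. \<sigma> (\<tau> i) * reversed Z (\<tau> i) 1) = - (\<Sum>i=k + d + 1..m. f i)"
    unfolding sum_negf[symmetric]
    by (intro sum.cong refl) (use Z0 \<tau>m in \<open>auto simp: reversed_def f_def\<close>)
  also have "max_path_sum (d - s) d (reversed ?X) = max_path_sum s d ?X - (\<Sum>l=1..d. ?X l 1)"
  proof (rule max_path_sum_reversed[OF sd])
    fix l assume "l \<in> {1..d}"
    then have "\<tau> (k + l) < m" using kd by (intro \<tau>m) auto
    then show "?X l 0 = 0" "continuous_on {0..1} (?X l)"
      using Z0 by (auto intro!: continuous_on_mult continuous_on_const Z)
  qed
  also have "(\<Sum>l=1..d. ?X l 1) = (\<Sum>i=k + 1..k + d. f i)"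
    using sum.shift_bounds_cl_nat_ivl[of f 1 k d] by (simp add: f_def add.commute)
  also have "- (\<Sum>i=k + d + 1..m. f i) + (max_path_sum s d ?X - (\<Sum>i=k + 1..k + d. f i)) =
      (\<Sum>i=1..k. f i) + max_path_sum s d ?X"
  \<comment> \<open>The ranks split into those before, in and after the block. As the total is 0,
    minus the sum over the last two ranges is the sum over the first.\<close>
  proof -
    have "(\<Sum>i=1..m. f i) = (\<Sum>i<m. \<sigma> i * Z i 1)"
      using sum.reindex_bij_betw[OF \<tau>, of "\<lambda>i. \<sigma> i * Z i 1"] by (simp add: f_def lessThan_atLeast0)
    moreover have "(\<Sum>i=1..m. f i) = (\<Sum>i=1..k + d. f i) + (\<Sum>i=k + d + 1..m. f i)"
      using sum.ub_add_nat[of 1 "k + d" f "m - (k + d)"] kd by simp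
    moreover have "(\<Sum>i=1..k + d. f i) = (\<Sum>i=1..k. f i) + (\<Sum>i=k + 1..k + d. f i)"
      by (rule sum.ub_add_nat) simp
    ultimately show ?thesis using total by simp
  qed
  finally show ?thesis by (simp add: path_functional_def f_def)
qed

theorem theorem4p1:
  fixes m :: nat and P :: "real mat" and \<pi> :: "nat \<Rightarrow> real" and \<Sigma> :: "real mat"
    and \<tau> :: "nat \<Rightarrow> nat" and M :: "'a measure" and B :: "nat \<Rightarrow> real \<Rightarrow> 'a \<Rightarrow> real"
  assumes "m \<ge> 2"
    and "stochastic_mat m P" and "irreducible_chain m P" and "aperiodic_chain m P"
    and "stationary_distribution m P \<pi>"
    and "asymptotic_covariance m P \<pi> \<Sigma>"
    and "sorting_permutation m \<pi> \<tau>"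
    and "brownian_motion M m (\<lambda>r s. \<Sigma> $$ (r, s) / (std_dev \<Sigma> r * std_dev \<Sigma> s)) B"
  shows "\<forall>r. 1 \<le> r \<and> r \<le> m - 1 \<longrightarrow>
     equal_in_law M (V_low m \<pi> \<tau> (std_dev \<Sigma>) B r) (V_high m \<pi> \<tau> (std_dev \<Sigma>) B r)"
proof (intro allI impI)
  fix r assume r: "1 \<le> r \<and> r \<le> m - 1"
  note bm = assms(8)
  let ?\<sigma> = "std_dev \<Sigma>"
  define k where "k = m_above m \<pi> \<tau> r"
  define d where "d = d_mult m \<pi> \<tau> r"
  have rm: "1 \<le> r" "r \<le> m" using r by auto
  note rb = rank_bounds[OF assms(7) rm]
  have kd: "k < r" "r \<le> k + d" "k + d \<le> m" using rb by (auto simp: k_def d_def)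
  have \<tau>: "bij_betw \<tau> {1..m} {0..<m}" using assms(7) by (simp add: sorting_permutation_def)
  have \<tau>m: "\<tau> i < m" if "1 \<le> i" "i \<le> m" for i using bij_betwE[OF \<tau>] that by auto
  define F where "F \<omega> = path_functional \<tau> ?\<sigma> {1..k} k (r - k) d (\<lambda>i t. B i t \<omega>)" for \<omega>
  define H where "H \<omega> = path_functional \<tau> ?\<sigma> {k + d + 1..m} k (d - (r - k)) d (\<lambda>i t. B i t \<omega>)" for \<omega>
  define H' where "H' \<omega> = path_functional \<tau> ?\<sigma> {k + d + 1..m} k (d - (r - k)) d (reversed (\<lambda>i t. B i t \<omega>))" for \<omega>
  have low: "V_low m \<pi> \<tau> ?\<sigma> B r = F"
    by (rule ext) (simp only: F_def k_def d_def V_low_eq[OF rb(1,2)])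
  have high: "V_high m \<pi> \<tau> ?\<sigma> B r = H"
    by (rule ext) (simp only: H_def k_def d_def V_high_eq[OF rb(1,2)])
  have sd: "r - k \<le> d" using kd by simp
  have Fm: "F \<in> borel_measurable M"
    unfolding F_def by (rule path_functional_reversal(1)[OF bm sd]) (use kd \<tau>m in auto)
  have Hm: "H \<in> borel_measurable M"
    unfolding H_def by (rule path_functional_reversal(1)[OF bm diff_le_self]) (use kd \<tau>m in auto)
  have HH': "distr M borel H = distr M borel H'"
    unfolding H_def H'_def by (rule path_functional_reversal(3)[OF bm diff_le_self]) (use kd \<tau>m in auto)
  have "AE \<omega> in M. (\<Sum>i<m. ?\<sigma> i * B i 1 \<omega>) = 0"
    by (rule centered_brownian_total[OF bm])
      (rule rescaled_covariance_total[OF _ assms(2,3,5,6)], use assms(1) in simp)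
  then have FH': "AE \<omega> in M. F \<omega> = H' \<omega>"
    using AE_space
  proof eventually_elim
    case (elim \<omega>)
    show ?case unfolding F_def H'_def
      by (rule path_functional_complement[OF \<tau> sd kd(3)])
        (use brownian_path[OF bm _ elim(2)] elim(1) in auto)
  qed
  have H'm: "H' \<in> borel_measurable M"
    unfolding H'_def by (rule path_functional_reversal(2)[OF bm diff_le_self]) (use kd \<tau>m in auto)
  have "distr M borel F = distr M borel H'"
    by (rule distr_cong_AE[OF refl refl FH' Fm H'm])
  then show "equal_in_law M (V_low m \<pi> \<tau> ?\<sigma> B r) (V_high m \<pi> \<tau> ?\<sigma> B r)"
    unfolding equal_in_law_def low high using Fm Hm HH' by simp
qed

end
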